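(* Let $P$ be a monic complex polynomial of degree $d$ whose roots are all simple, let $Q$ be a complex polynomial of degree $d-1$ that is nonzero at every root of $P$, and let $R(z^{-1})=\sum_{j\ge0}R_jz^{-j}$ be a power series that converges on the region $|z|>A$ for some $A\ge0$. Suppose $P$ has a root $-\alpha$ for which $\tau_\alpha:=Q(-\alpha)/P'(-\alpha)$ is real and positive. Let $\Omega_\alpha\subset\mathbb{C}$ be a simply connected open set, star-shaped around $\alpha$, such that $\alpha\notin\Omega_\alpha$, $\alpha\in\overline{\Omega_\alpha}$, and $\overline{\Omega_\alpha}$ contains no root of the polynomial $\zeta\mapsto P(-\zeta)$ other than $\alpha$. Then the equation $$\hat{\mathcal{P}}_\alpha\psi_\alpha=0$$ has a unique solution $\psi_\alpha$ in the affine subspace $$(\zeta-\alpha)^{\tau_\alpha-1}+\mathcal{H}L^\infty_{\tau_\alpha,\bullet}(\Omega_\alpha)$$ of the space $\mathcal{H}L^\infty_{\tau_\alpha-1,\bullet}(\Omega_\alpha)$.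
   Context: Star-shaped around $\alpha$ means that for every $a\in\Omega_\alpha$ the segment $\{\alpha+t(a-\alpha):0<t\le1\}$ lies in $\Omega_\alpha$. The operator $\hat{\mathcal{P}}_\alpha=P(-\zeta)+\partial^{-1}_{\zeta,\alpha}\circ Q(-\zeta)+\partial^{-2}_{\zeta,\alpha}\circ R(\partial^{-1}_{\zeta,\alpha})$, where $\partial^{-1}_{\zeta,\alpha}$ is integration from $\alpha$, is given explicitly by $$[\hat{\mathcal{P}}_\alpha\varphi](a)=P(-a)\varphi(a)+\int_\alpha^aQ(-a')\varphi(a')\,da'+\int_\alpha^ak_R(a,a')\varphi(a')\,da',\qquad k_R(a,a')=\sum_{j=0}^\infty\frac{R_j}{(j+1)!}(a-a')^{j+1},$$ with integrals (possibly improper at $\alpha$) along the straight segment from $\alpha$ to $a$. For $\sigma,\Lambda\in\mathbb{R}$, $\mathcal{H}L^\infty_{\sigma,\Lambda}(\Omega_\alpha)$ is the space of holomorphic functions $f$ on $\Omega_\alpha$ with $\sup_{\zeta\in\Omega_\alpha}|\zeta-\alpha|^{-\sigma}e^{-\Lambda|\zeta-\alpha|}|f(\zeta)|<\infty$, and $\mathcal{H}L^\infty_{\sigma,\bullet}(\Omega_\alpha)=\bigcup_{\Lambda\in\mathbb{R}}\mathcal{H}L^\infty_{\sigma,\Lambda}(\Omega_\alpha)$. The power $(\zeta-\alpha)^{\tau_\alpha-1}$ denotes a fixed holomorphic branch on $\Omega_\alpha$. *)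

theory Defs
  imports "HOL-Complex_Analysis.Complex_Analysis"
begin

text \<open>
  A function on an open set \<open>\<Omega>\<close> is represented by a total function on the complex
  numbers whose values outside \<open>\<Omega>\<close> are irrelevant; two such functions are identified
  when they agree on \<open>\<Omega>\<close>.
\<close>

text \<open>Unlike for the library's \<open>starlike\<close>, the centre \<open>\<alpha>\<close> need not belong to the set.\<close>

definition star_shaped_around :: "complex \<Rightarrow> complex set \<Rightarrow> bool" where
  "star_shaped_around \<alpha> \<Omega> \<longleftrightarrow>
     (\<forall>a\<in>\<Omega>. \<forall>t::real. 0 < t \<and> t \<le> 1 \<longrightarrow> \<alpha> + of_real t * (a - \<alpha>) \<in> \<Omega>)"

definition HL_inf :: "real \<Rightarrow> real \<Rightarrow> complex \<Rightarrow> complex set \<Rightarrow> (complex \<Rightarrow> complex) set" where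
  "HL_inf \<sigma> \<Lambda> \<alpha> \<Omega> =
     {f. f holomorphic_on \<Omega> \<and>
         bdd_above ((\<lambda>\<zeta>. cmod (\<zeta> - \<alpha>) powr (- \<sigma>) * exp (- \<Lambda> * cmod (\<zeta> - \<alpha>)) * cmod (f \<zeta>)) ` \<Omega>)}"

definition HL_inf_bullet :: "real \<Rightarrow> complex \<Rightarrow> complex set \<Rightarrow> (complex \<Rightarrow> complex) set" where
  "HL_inf_bullet \<sigma> \<alpha> \<Omega> = (\<Union>\<Lambda>. HL_inf \<sigma> \<Lambda> \<alpha> \<Omega>)"

text \<open>\<open>p\<close> is a holomorphic branch on \<open>\<Omega>\<close> of the power of \<open>\<zeta> - \<alpha>\<close> with exponent \<open>s\<close>:\<close>

definition power_branch :: "complex \<Rightarrow> complex \<Rightarrow> complex set \<Rightarrow> (complex \<Rightarrow> complex) \<Rightarrow> bool" where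
  "power_branch s \<alpha> \<Omega> p \<longleftrightarrow>
     (\<exists>L. L holomorphic_on \<Omega> \<and> (\<forall>\<zeta>\<in>\<Omega>. exp (L \<zeta>) = \<zeta> - \<alpha> \<and> p \<zeta> = exp (s * L \<zeta>)))"

definition kernel_R :: "(nat \<Rightarrow> complex) \<Rightarrow> complex \<Rightarrow> complex \<Rightarrow> complex" where
  "kernel_R R a a' = (\<Sum>j. R j / fact (j + 1) * (a - a') ^ (j + 1))"

text \<open>
  \<open>contour_integral\<close> is based on the Henstock--Kurzweil integral of
  \<open>\<lambda>t. f (linepath \<alpha> a t) * (a - \<alpha>)\<close> over the unit interval, which includes integrals
  that are improper at \<open>\<alpha>\<close> and does not depend on the value of \<open>f\<close> at \<open>\<alpha>\<close>. For \<open>\<phi>\<close> in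
  \<open>HL_inf_bullet \<sigma> \<alpha> \<Omega>\<close> with \<open>\<sigma> > - 1\<close> and \<open>\<Omega>\<close> star-shaped around \<open>\<alpha>\<close>, both integrals
  below converge absolutely for every \<open>a \<in> \<Omega>\<close>, if the coefficients \<open>R\<close> are those of a
  power series in \<open>1/z\<close> that converges for all large \<open>z\<close>.
\<close>

definition P_hat ::
  "complex poly \<Rightarrow> complex poly \<Rightarrow> (nat \<Rightarrow> complex) \<Rightarrow> complex \<Rightarrow>
   (complex \<Rightarrow> complex) \<Rightarrow> complex \<Rightarrow> complex" where
  "P_hat P Q R \<alpha> \<phi> a =
     poly P (- a) * \<phi> a
     + contour_integral (linepath \<alpha> a) (\<lambda>a'. poly Q (- a') * \<phi> a')
     + contour_integral (linepath \<alpha> a) (\<lambda>a'. kernel_R R a a' * \<phi> a')"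

end

theory Submission
  imports Defs "HOL-Computational_Algebra.Fundamental_Theorem_Algebra"
begin

text \<open>
  Write \<open>P (- \<zeta>) = (\<zeta> - \<alpha>) * p1 \<zeta>\<close> and let \<open>\<phi> = b + f\<close>, where \<open>b\<close> is the branch of the power. The
  equation becomes the fixed-point equation \<open>\<phi> = T \<phi>\<close> with
  \<open>T \<phi> = - (\<integral> Q (- \<zeta>) \<phi> + \<integral> k\<^sub>R \<phi>) / P (- \<zeta>)\<close>, hence \<open>f = T f + (T b - b)\<close>. Since
  \<open>Q (- \<alpha>) = - \<tau> * p1 \<alpha>\<close>, the leading terms at \<open>\<alpha>\<close> cancel in \<open>T b - b\<close>, which is therefore of
  order \<open>\<tau>\<close>. In the norm weighted by \<open>r powr \<tau> * exp (\<Lambda> * r)\<close>, with \<open>r = \<bar>\<zeta> - \<alpha>\<bar>\<close>, the norm of \<open>T\<close> is at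
  most \<open>\<tau> / (\<tau> + 1) + O(1 / \<Lambda>)\<close>, because \<open>\<integral>\<^sub>0\<^sup>r s powr \<tau> ds = r powr (\<tau> + 1) / (\<tau> + 1)\<close> and because
  \<open>\<bar>p1\<bar> \<ge> c * (1 + r) ^ (d - 1)\<close> absorbs the growth of \<open>Q\<close>. So \<open>T\<close> is a contraction for large \<open>\<Lambda>\<close>,
  which yields existence (Neumann series) and uniqueness.
\<close>

text \<open>The shape of the affine space is dictated by a borderline case. On functions of order
  \<open>\<sigma>\<close> at \<alpha> the model operator
  \<open>f \<mapsto> (\<tau> / (z - \<alpha>)) * \<integral> f\<close> has the bound
  \<open>\<tau> / (\<sigma> + 1)\<close>. For \<open>\<sigma> = \<tau> - 1\<close> this is exactly
  1, and the power itself is fixed by the model operator. The equation is also homogeneous, so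
  multiples of a solution are solutions. Fixing the coefficient of the power removes this freedom,
  and the correction, of order \<tau>, meets a bound below 1. The exponential weight cannot help at
  \<alpha>; it controls the rest of a possibly unbounded domain. Integrating
  \<open>exp (\<Lambda> * s)\<close> up to \<open>r\<close> gains \<open>1 / \<Lambda>\<close> but
  no power of \<open>r\<close>, so each error term must bring its own factor \<open>r\<close> to pay
  for the division by \<open>z - \<alpha>\<close>. This is why the polynomials enter through their
  increments from \<alpha>, and why the linear vanishing of the kernel on the diagonal matters. For
  \<open>\<tau> < 1\<close> the power is unbounded at \<alpha>; the integrals are then improper, and
  holomorphy in the endpoint has to be obtained by truncation.\<close>

section \<open>Polynomials and the kernel\<close>

lemma poly_growth_bound:
  fixes u :: "complex poly"
  assumes "degree u \<le> n"
  obtains C where "C \<ge> 0" "\<And>z. cmod (poly u z) \<le> C * (1 + cmod (z - \<alpha>)) ^ n"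
proof -
  define v where "v = pcompose u [:\<alpha>, 1:]"
  define C where "C = (\<Sum>i\<le>degree v. cmod (coeff v i))"
  have dv: "degree v \<le> n"
    using assms by (simp add: v_def degree_pcompose)
  have "cmod (poly u z) \<le> C * (1 + cmod (z - \<alpha>)) ^ n" for z
  proof -
    have "poly u z = poly v (z - \<alpha>)"
      by (simp add: v_def poly_pcompose)
    also have "cmod \<dots> \<le> (\<Sum>i\<le>degree v. cmod (coeff v i) * cmod (z - \<alpha>) ^ i)"
      unfolding poly_altdef by (intro sum_norm_le) (simp add: norm_mult norm_power)
    also have "\<dots> \<le> (\<Sum>i\<le>degree v. cmod (coeff v i) * (1 + cmod (z - \<alpha>)) ^ n)"
    proof (intro sum_mono mult_left_mono)
      fix i assume "i \<in> {..degree v}"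
      then have "i \<le> n" using dv by simp
      have "cmod (z - \<alpha>) ^ i \<le> (1 + cmod (z - \<alpha>)) ^ i"
        by (intro power_mono) auto
      also have "\<dots> \<le> (1 + cmod (z - \<alpha>)) ^ n"
        using \<open>i \<le> n\<close> by (intro power_increasing) auto
      finally show "cmod (z - \<alpha>) ^ i \<le> (1 + cmod (z - \<alpha>)) ^ n" .
    qed auto
    finally show ?thesis by (simp add: C_def sum_distrib_right)
  qed
  moreover have "C \<ge> 0" by (simp add: C_def sum_nonneg)
  ultimately show ?thesis using that by blast
qed

lemma poly_lower_bound:
  fixes u :: "complex poly"
  assumes "closed S" and "\<And>z. z \<in> S \<Longrightarrow> poly u z \<noteq> 0" and "u \<noteq> 0"
  obtains c where "c > 0" "\<And>z. z \<in> S \<Longrightarrow> c * (1 + cmod (z - \<alpha>)) ^ degree u \<le> cmod (poly u z)"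
proof -
  have "\<exists>c>0. \<forall>z\<in>S. c * (1 + cmod (z - \<alpha>)) ^ degree u \<le> cmod (poly u z)"
    using assms(2,3)
  proof (induction "degree u" arbitrary: u)
    case 0
    then obtain k where "u = [:k:]" using degree_eq_zeroE by metis
    with 0 show ?case by (intro exI[of _ "cmod k"]) auto
  next
    case (Suc n)
    then have "\<not> constant (poly u)"
      using constant_degree[of u] by simp
    then obtain w where "poly u w = 0"
      using Fundamental_Theorem_Algebra.fundamental_theorem_of_algebra by blast
    then obtain v where u: "u = [:- w, 1:] * v"
      by (auto simp: poly_eq_0_iff_dvd elim: dvdE)
    with Suc have v0: "v \<noteq> 0" by auto
    have dv: "degree u = Suc (degree v)"
      using v0 unfolding u by (subst degree_mult_eq) auto
    obtain c where c: "c > 0" "\<And>z. z \<in> S \<Longrightarrow> c * (1 + cmod (z - \<alpha>)) ^ degree v \<le> cmod (poly v z)"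
      using Suc(1)[of v] Suc(2,3) v0 dv u by auto
    have "w \<notin> S" using Suc(3) \<open>poly u w = 0\<close> by blast
    then obtain e where e: "e > 0" "\<And>z. z \<in> S \<Longrightarrow> e \<le> cmod (z - w)"
      using separate_point_closed[OF \<open>closed S\<close>] by (metis dist_commute dist_norm)
    \<comment> \<open>In \<open>1 + cmod (z - \<alpha>) \<le> (1 + cmod (w - \<alpha>)) + cmod (z -
      w)\<close> the constant part is at most \<open>1 + cmod (w - \<alpha>)\<close> times
      \<open>cmod (z - w) / e\<close>; \<open>k\<close> collects the two coefficients of
      \<open>cmod (z - w)\<close>.\<close>
    define k where "k = (1 + cmod (w - \<alpha>)) / e + 1"
    have k: "k > 0" using e by (auto simp: k_def intro!: add_nonneg_pos divide_nonneg_pos)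
    have lin: "1 / k * (1 + cmod (z - \<alpha>)) \<le> cmod (z - w)" if "z \<in> S" for z
    proof -
      have "1 + cmod (z - \<alpha>) \<le> (1 + cmod (w - \<alpha>)) * 1 + cmod (z - w)"
        using norm_triangle_ineq[of "z - w" "w - \<alpha>"] by simp
      also have "\<dots> \<le> (1 + cmod (w - \<alpha>)) * (cmod (z - w) / e) + cmod (z - w)"
        using e(1) e(2)[OF that] by (intro add_mono mult_left_mono) (auto simp: field_simps)
      also have "\<dots> = k * cmod (z - w)" by (simp add: k_def field_simps)
      finally show ?thesis using k by (simp add: field_simps)
    qed
    have "c / k * (1 + cmod (z - \<alpha>)) ^ degree u \<le> cmod (poly u z)" if "z \<in> S" for z
    proof -
      have "c / k * (1 + cmod (z - \<alpha>)) ^ degree u =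
          (1 / k * (1 + cmod (z - \<alpha>))) * (c * (1 + cmod (z - \<alpha>)) ^ degree v)"
        by (simp add: dv)
      also have "\<dots> \<le> cmod (z - w) * cmod (poly v z)"
        using lin[OF that] c that by (intro mult_mono) auto
      also have "\<dots> = cmod (poly u z)"
        by (simp add: u norm_mult[symmetric] algebra_simps)
      finally show ?thesis .
    qed
    then show ?case using c(1) k by (intro exI[of _ "c / k"]) auto
  qed
  then show ?thesis using that by blast
qed

text \<open>The increment is divisible by \<open>z - \<alpha>\<close>. The factor
  \<open>cmod (z - \<alpha>)\<close> supplies the extra order at \<alpha>, while the power
  \<open>n\<close> matches the lower bound on the cofactor of \<open>P (- z)\<close>, so that the
  quotient stays bounded at infinity.\<close>

lemma poly_increment_bound:
  fixes u :: "complex poly"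
  assumes "degree u \<le> n"
  obtains C where "C \<ge> 0"
    "\<And>z. cmod (poly u z - poly u \<alpha>) \<le> C * cmod (z - \<alpha>) * (1 + cmod (z - \<alpha>)) ^ n"
proof -
  have "poly (u - [:poly u \<alpha>:]) \<alpha> = 0" by simp
  then obtain v where v: "u - [:poly u \<alpha>:] = [:- \<alpha>, 1:] * v"
    using poly_eq_0_iff_dvd by (metis dvdE)
  have "degree v \<le> n"
  proof (cases "v = 0")
    case False
    then have "Suc (degree v) = degree (u - [:poly u \<alpha>:])"
      unfolding v by (subst degree_mult_eq) auto
    also have "\<dots> \<le> n" using degree_diff_le_max[of u "[:poly u \<alpha>:]"] assms by simp
    finally show ?thesis by simp
  qed simp
  then obtain C where C: "C \<ge> 0" "\<And>z. cmod (poly v z) \<le> C * (1 + cmod (z - \<alpha>)) ^ n"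
    using poly_growth_bound[of v n \<alpha>] by blast
  have "poly u z - poly u \<alpha> = (z - \<alpha>) * poly v z" for z
    using arg_cong[OF v, of "\<lambda>p. poly p z"] by (simp add: algebra_simps)
  then have "cmod (poly u z - poly u \<alpha>) \<le> C * cmod (z - \<alpha>) * (1 + cmod (z - \<alpha>)) ^ n" for z
    using mult_left_mono[OF C(2), of "cmod (z - \<alpha>)" z] by (simp add: norm_mult mult_ac)
  with C(1) show ?thesis using that by blast
qed

text \<open>\<open>K\<close> is the Borel transform of \<open>R\<close> multiplied by the inverse
  square of \<open>z\<close>. Convergence outside a disc bounds \<open>R j\<close> by a geometric
  sequence, and the factorials turn this into an entire function of exponential type. Its series
  starts at the first power of \<open>u\<close>; the resulting factor \<open>cmod u\<close> later
  pays for the division by \<open>a - \<alpha>\<close>.\<close>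

lemma kernel_R_entire:
  fixes R :: "nat \<Rightarrow> complex"
  assumes "A \<ge> 0" and conv: "\<And>z. cmod z > A \<Longrightarrow> summable (\<lambda>j. R j * inverse z ^ j)"
  obtains K N B where "K holomorphic_on UNIV" "N \<ge> 0" "B > 0"
    "\<And>a a'. kernel_R R a a' = K (a - a')" "\<And>u. cmod (K u) \<le> N * cmod u * exp (B * cmod u)"
proof -
  \<comment> \<open>A radius inside the region of convergence that stays positive when
    \<open>A = 0\<close>.\<close>
  define B where "B = A + 1"
  have B: "B > 0" using assms(1) by (simp add: B_def)
  have "summable (\<lambda>j. R j * inverse (complex_of_real B) ^ j)"
    using assms by (intro conv) (simp add: B_def del: of_real_add)
  then have "Bseq (\<lambda>j. R j * inverse (complex_of_real B) ^ j)"
    using summable_LIMSEQ_zero convergent_imp_Bseq convergentI by blast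
  then obtain N where N: "N > 0" "\<And>j. cmod (R j * inverse (complex_of_real B) ^ j) \<le> N"
    by (auto elim: BseqE)
  have Rj: "cmod (R j) \<le> N * B ^ j" for j
    using N(2)[of j] B
    by (simp add: norm_mult norm_power norm_inverse divide_simps norm_divide flip: power_inverse)
  define c where "c = (\<lambda>j. R j / fact (j + 1))"
  have cj: "cmod (c j * u ^ j) \<le> N * ((B * cmod u) ^ j /\<^sub>R fact j)" for j u
  proof -
    have "cmod (c j * u ^ j) = cmod (R j) * cmod u ^ j / fact (j + 1)"
      by (simp add: c_def norm_mult norm_divide norm_power del: fact_Suc)
    also have "\<dots> \<le> N * B ^ j * cmod u ^ j / fact j"
      using Rj[of j] N(1) B by (intro frac_le mult_right_mono fact_mono mult_nonneg_nonneg) auto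
    finally show ?thesis by (simp add: field_simps)
  qed
  have major: "(\<lambda>j. N * ((B * cmod u) ^ j /\<^sub>R fact j)) sums (N * exp (B * cmod u))" for u
    by (intro sums_mult exp_converges)
  have sm: "summable (\<lambda>j. cmod (c j * u ^ j))" for u
    by (rule summable_comparison_test[OF _ sums_summable[OF major[of u]]])
      (use cj in auto)
  have sm': "summable (\<lambda>j. c j * u ^ j)" for u
    by (rule summable_norm_cancel[OF sm])
  define K where "K = (\<lambda>u. u * (\<Sum>j. c j * u ^ j))"
  have "K holomorphic_on UNIV"
    unfolding K_def
    by (intro holomorphic_intros)
      (use termdiffs_strong_converges_everywhere[OF sm'] in
        \<open>auto simp: holomorphic_on_def field_differentiable_def intro: has_field_derivative_at_within\<close>)
  moreover have "kernel_R R a a' = K (a - a')" for a a'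
    unfolding kernel_R_def K_def using suminf_mult[OF sm'[of "a - a'"], of "a - a'"]
    by (simp add: c_def mult_ac)
  moreover have "cmod (K u) \<le> N * cmod u * exp (B * cmod u)" for u
  proof -
    have "cmod (\<Sum>j. c j * u ^ j) \<le> (\<Sum>j. cmod (c j * u ^ j))"
      using summable_norm[OF sm] .
    also have "\<dots> \<le> N * exp (B * cmod u)"
      using suminf_le[OF cj sm sums_summable[OF major]] sums_unique[OF major[of u]] by simp
    finally show ?thesis
      by (simp add: K_def norm_mult mult_left_mono mult_ac)
        (metis mult.commute mult.left_commute mult_left_mono norm_ge_zero)
  qed
  ultimately show ?thesis using that N(1) B by (meson less_imp_le)
qed

section \<open>Contractions in weighted supremum norms\<close>

text \<open>The solution is the sum of the iterates of \<open>T\<close> on \<open>g\<close>. An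
  integral operator is additive only where its integrals converge, so additivity enters as a
  conditional statement about differences of functions with a weighted bound, and partial sums and
  tails have to be bounded before \<open>T\<close> may act on them. Continuity of \<open>w\<close>
  makes weighted bounds locally uniform, which keeps the limit holomorphic.\<close>

lemma neumann_series:
  fixes T :: "(complex \<Rightarrow> complex) \<Rightarrow> complex \<Rightarrow> complex" and w :: "complex \<Rightarrow> real"
  assumes "open \<Omega>" and w: "continuous_on \<Omega> w" "\<And>z. z \<in> \<Omega> \<Longrightarrow> w z \<ge> 0" and \<kappa>: "0 \<le> \<kappa>" "\<kappa> < 1"
    and hol: "\<And>f M. f holomorphic_on \<Omega> \<Longrightarrow> (\<And>z. z \<in> \<Omega> \<Longrightarrow> cmod (f z) \<le> M * w z) \<Longrightarrow>
           M \<ge> 0 \<Longrightarrow> T f holomorphic_on \<Omega>"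
    and bd: "\<And>f M z. f holomorphic_on \<Omega> \<Longrightarrow> (\<And>z. z \<in> \<Omega> \<Longrightarrow> cmod (f z) \<le> M * w z) \<Longrightarrow>
           M \<ge> 0 \<Longrightarrow> z \<in> \<Omega> \<Longrightarrow> cmod (T f z) \<le> \<kappa> * M * w z"
    and diff: "\<And>f g M M' z. f holomorphic_on \<Omega> \<Longrightarrow> (\<And>z. z \<in> \<Omega> \<Longrightarrow> cmod (f z) \<le> M * w z) \<Longrightarrow>
           g holomorphic_on \<Omega> \<Longrightarrow> (\<And>z. z \<in> \<Omega> \<Longrightarrow> cmod (g z) \<le> M' * w z) \<Longrightarrow>
           M \<ge> 0 \<Longrightarrow> M' \<ge> 0 \<Longrightarrow> z \<in> \<Omega> \<Longrightarrow> T (\<lambda>z. f z - g z) z = T f z - T g z"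
    and g: "g holomorphic_on \<Omega>" "\<And>z. z \<in> \<Omega> \<Longrightarrow> cmod (g z) \<le> G * w z" "G \<ge> 0"
  obtains f M where "f holomorphic_on \<Omega>" "\<And>z. z \<in> \<Omega> \<Longrightarrow> cmod (f z) \<le> M * w z" "M \<ge> 0"
    "\<And>z. z \<in> \<Omega> \<Longrightarrow> f z = T f z + g z"
proof -
  define s where "s = (\<lambda>n. (T ^^ n) g)"
  have s: "s n holomorphic_on \<Omega> \<and> (\<forall>z\<in>\<Omega>. cmod (s n z) \<le> \<kappa> ^ n * G * w z)" for n
  proof (induction n)
    case 0
    then show ?case using g by (simp add: s_def)
  next
    case (Suc n)
    have "\<kappa> ^ n * G \<ge> 0" using \<kappa> g(3) by simp
    with Suc hol[of "s n" "\<kappa> ^ n * G"] bd[of "s n" "\<kappa> ^ n * G"] show ?case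
      by (auto simp: s_def mult.assoc)
  qed
  define S where "S = (\<lambda>n z. \<Sum>i<n. s i z)"
  define M where "M = G / (1 - \<kappa>)"
  have M: "M \<ge> 0" using \<kappa> g(3) by (simp add: M_def)
  have S_hol: "S n holomorphic_on \<Omega>" for n
    unfolding S_def using s by (intro holomorphic_intros) auto
  have sm: "summable (\<lambda>n. \<kappa> ^ n * G * x)" for x
    using \<kappa> by (intro summable_mult2 summable_geometric) auto
  define f where "f = (\<lambda>z. \<Sum>i. s i z)"
  have smz: "summable (\<lambda>i. cmod (s i z))" if "z \<in> \<Omega>" for z
    by (rule summable_comparison_test[OF _ sm[of "w z"]]) (use s that in auto)
  have tail: "cmod (f z - S n z) \<le> \<kappa> ^ n * M * w z" if "z \<in> \<Omega>" for z n
  proof -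
    have "f z - S n z = (\<Sum>i. s (i + n) z)"
      using suminf_minus_initial_segment[OF summable_norm_cancel[OF smz[OF that]], of n]
      by (simp add: f_def S_def)
    also have "cmod \<dots> \<le> (\<Sum>i. \<kappa> ^ i * (\<kappa> ^ n * G * w z))"
    proof (rule norm_suminf_le)
      show "cmod (s (i + n) z) \<le> \<kappa> ^ i * (\<kappa> ^ n * G * w z)" for i
        using s[of "i + n"] that by (auto simp: power_add mult_ac)
      show "summable (\<lambda>i. \<kappa> ^ i * (\<kappa> ^ n * G * w z))"
        using \<kappa> by (intro summable_mult2 summable_geometric) auto
    qed
    also have "\<dots> = 1 / (1 - \<kappa>) * (\<kappa> ^ n * G * w z)"
      using \<kappa> by (subst suminf_mult2[symmetric]) (auto simp: suminf_geometric summable_geometric)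
    finally show ?thesis by (simp add: M_def mult_ac)
  qed
  have f_bd: "cmod (f z) \<le> M * w z" if "z \<in> \<Omega>" for z
    using tail[OF that, of 0] by (simp add: S_def)
  have S_bd: "cmod (S n z) \<le> (M + M) * w z" if "z \<in> \<Omega>" for z n
  proof -
    have "cmod (S n z) \<le> cmod (f z) + cmod (f z - S n z)"
      using norm_triangle_ineq4[of "f z" "f z - S n z"] by simp
    also have "\<dots> \<le> M * w z + \<kappa> ^ n * M * w z" using f_bd tail that by (intro add_mono) auto
    also have "\<kappa> ^ n * M * w z \<le> 1 * M * w z"
      using \<kappa> M w(2)[OF that] by (intro mult_right_mono power_le_one) auto
    finally show ?thesis by (simp add: algebra_simps)
  qed
  have f_hol: "f holomorphic_on \<Omega>"
  proof (rule holomorphic_uniform_sequence[OF \<open>open \<Omega>\<close>, of S])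
    fix x assume "x \<in> \<Omega>"
    then obtain e where e: "e > 0" "cball x e \<subseteq> \<Omega>"
      using \<open>open \<Omega>\<close> open_contains_cball by blast
    obtain D where D: "\<And>z. z \<in> cball x e \<Longrightarrow> w z \<le> D"
      using continuous_attains_sup[OF compact_cball _ continuous_on_subset[OF w(1) e(2)]] e(1)
      by fastforce
    have "uniform_limit (cball x e) (\<lambda>n z. \<Sum>i<n. s i z) f sequentially"
      unfolding f_def
    proof (rule Weierstrass_m_test[OF _ sm[of D]])
      fix n z assume z: "z \<in> cball x e"
      have "cmod (s n z) \<le> \<kappa> ^ n * G * w z" using s e z by blast
      also have "\<dots> \<le> \<kappa> ^ n * G * D" using D[OF z] \<kappa> g(3) by (intro mult_left_mono) auto
      finally show "cmod (s n z) \<le> \<kappa> ^ n * G * D" .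
    qed
    with e show "\<exists>d>0. cball x d \<subseteq> \<Omega> \<and> uniform_limit (cball x d) S f sequentially"
      unfolding S_def by blast
  qed (rule S_hol)
  \<comment> \<open>Writing \<open>S n\<close> as \<open>S (Suc n)\<close> minus \<open>s n\<close>
    reduces the sum to the hypothesis on differences; the base case, \<open>T\<close> of the zero
    function, is read off from \<open>g - g\<close>.\<close>
  have TS: "T (S n) z = S (Suc n) z - g z" if "z \<in> \<Omega>" for n z
  proof (induction n)
    case 0
    have "T (\<lambda>z. g z - g z) z = T g z - T g z"
      using g that by (intro diff) auto
    then show ?case by (simp add: S_def s_def)
  next
    case (Suc n)
    have "T (\<lambda>z. S (Suc n) z - s n z) z = T (S (Suc n)) z - T (s n) z"
      by (rule diff[of _ "M + M" _ "\<kappa> ^ n * G"]) (use S_hol S_bd s M \<kappa> g(3) that in auto)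
    moreover have "(\<lambda>z. S (Suc n) z - s n z) = S n" by (simp add: S_def fun_eq_iff)
    ultimately have "T (S (Suc n)) z = S (Suc n) z - g z + T (s n) z" using Suc by simp
    moreover have "S (Suc (Suc n)) z = S (Suc n) z + T (s n) z" by (simp add: S_def s_def)
    ultimately show ?case by simp
  qed
  have "f z = T f z + g z" if z: "z \<in> \<Omega>" for z
  proof -
    \<comment> \<open>The contraction bound on the tail \<open>f - S n\<close> takes the place of
      continuity of \<open>T\<close>: it puts \<open>T f + g\<close> as close to
      \<open>S (Suc n)\<close> as \<open>f\<close> is.\<close>
    have est: "cmod (T f z + g z - S (Suc n) z) \<le> \<kappa> ^ n * (\<kappa> * M * w z)" for n
    proof -
      have "T f z + g z - S (Suc n) z = T f z - T (S n) z" using TS[OF z] by simp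
      also have "\<dots> = T (\<lambda>z. f z - S n z) z"
        by (rule diff[symmetric, of _ M _ "M + M"]) (use f_hol f_bd S_hol S_bd M z in auto)
      also have "cmod \<dots> \<le> \<kappa> * (\<kappa> ^ n * M) * w z"
        by (rule bd) (use f_hol S_hol tail M \<kappa> z in \<open>auto intro!: holomorphic_intros\<close>)
      finally show ?thesis by (simp add: mult_ac)
    qed
    have lim0: "(\<lambda>n. \<kappa> ^ n * x) \<longlonglongrightarrow> 0" for x
      using \<kappa> by (intro tendsto_mult_left_zero LIMSEQ_power_zero) auto
    have "(\<lambda>n. T f z + g z - S (Suc n) z) \<longlonglongrightarrow> 0"
      by (rule Lim_null_comparison[OF _ lim0[of "\<kappa> * M * w z"]]) (use est in auto)
    moreover have "(\<lambda>n. f z - S (Suc n) z) \<longlonglongrightarrow> 0"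
      by (rule Lim_null_comparison[OF _ lim0[of "\<kappa> * M * w z"]])
        (use tail[OF z, of "Suc _"] in \<open>auto simp: mult_ac\<close>)
    ultimately have "(\<lambda>n. (T f z + g z - S (Suc n) z) - (f z - S (Suc n) z)) \<longlonglongrightarrow> 0 - 0"
      by (rule tendsto_diff)
    then have "T f z + (g z - f z) = 0" by (simp add: LIMSEQ_const_iff)
    then show ?thesis by (metis add_diff_eq eq_iff_diff_eq_0)
  qed
  with f_hol f_bd M that show ?thesis by blast
qed

lemma contraction_fixed_zero:
  fixes T :: "(complex \<Rightarrow> complex) \<Rightarrow> complex \<Rightarrow> complex" and w :: "complex \<Rightarrow> real"
  assumes \<kappa>: "0 \<le> \<kappa>" "\<kappa> < 1"
    and bd: "\<And>f M z. f holomorphic_on \<Omega> \<Longrightarrow> (\<And>z. z \<in> \<Omega> \<Longrightarrow> cmod (f z) \<le> M * w z) \<Longrightarrow>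
           M \<ge> 0 \<Longrightarrow> z \<in> \<Omega> \<Longrightarrow> cmod (T f z) \<le> \<kappa> * M * w z"
    and f: "f holomorphic_on \<Omega>" "\<And>z. z \<in> \<Omega> \<Longrightarrow> cmod (f z) \<le> M * w z" "M \<ge> 0"
    and fp: "\<And>z. z \<in> \<Omega> \<Longrightarrow> f z = T f z" and "z \<in> \<Omega>"
  shows "f z = 0"
proof -
  have *: "\<forall>z\<in>\<Omega>. cmod (f z) \<le> (\<kappa> ^ n * M) * w z" for n
  proof (induction n)
    case (Suc n)
    show ?case
    proof
      fix z assume "z \<in> \<Omega>"
      then have "cmod (T f z) \<le> \<kappa> * (\<kappa> ^ n * M) * w z"
        using f Suc \<kappa> by (intro bd) auto
      then show "cmod (f z) \<le> (\<kappa> ^ Suc n * M) * w z"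
        using fp[OF \<open>z \<in> \<Omega>\<close>] by (simp add: mult_ac)
    qed
  qed (use f in auto)
  have "(\<lambda>n. \<kappa> ^ n * (M * w z)) \<longlonglongrightarrow> 0"
    using \<kappa> by (intro tendsto_mult_left_zero LIMSEQ_power_zero) auto
  then have "(\<lambda>n. f z) \<longlonglongrightarrow> 0"
    by (rule Lim_null_comparison[rotated]) (use * \<open>z \<in> \<Omega>\<close> in \<open>auto simp: mult.assoc\<close>)
  then show ?thesis by (simp add: LIMSEQ_const_iff)
qed

section \<open>Volterra integrals along segments\<close>

text \<open>The interval \<open>{0<..1}\<close> leaves out the junk value of \<open>h\<close> at \<open>\<alpha>\<close>.\<close>

definition volterra_integrand ::
  "complex \<Rightarrow> (complex \<Rightarrow> complex) \<Rightarrow> (complex \<Rightarrow> complex) \<Rightarrow> complex \<Rightarrow> real \<Rightarrow> complex" where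
  "volterra_integrand \<alpha> K h a t =
     K (of_real (1 - t) * (a - \<alpha>)) * h (\<alpha> + of_real t * (a - \<alpha>)) * (a - \<alpha>)"

definition volterra ::
  "complex \<Rightarrow> (complex \<Rightarrow> complex) \<Rightarrow> (complex \<Rightarrow> complex) \<Rightarrow> complex \<Rightarrow> complex" where
  "volterra \<alpha> K h a = integral {0<..1} (volterra_integrand \<alpha> K h a)"

section \<open>Half-open and closed intervals of integration\<close>

lemma integral_greaterThanAtMost_eq:
  fixes f :: "real \<Rightarrow> complex"
  shows "integral {0<..c} f = integral {0..c} f"
  by (rule integral_spike_set; rule negligible_subset[of "{0}"]) auto

lemma integrable_greaterThanAtMost_iff:
  fixes f :: "real \<Rightarrow> 'a::banach"
  shows "f integrable_on {0<..c} \<longleftrightarrow> f integrable_on {0..c}"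
  by (rule integrable_spike_set_eq; rule negligible_subset[of "{0}"]) auto

lemma has_integral_greaterThanAtMost_iff:
  fixes f :: "real \<Rightarrow> 'a::banach"
  shows "(f has_integral i) {0<..c} \<longleftrightarrow> (f has_integral i) {0..c}"
  by (rule has_integral_spike_set_eq; rule negligible_subset[of "{0}"]) auto

text \<open>This holds for every \<open>h\<close>, integrable or not: both sides are the same
  Henstock-Kurzweil integral up to the single parameter 0.\<close>

lemma contour_integral_linepath_eq_volterra:
  "contour_integral (linepath \<alpha> a) (\<lambda>z. K (a - z) * h z) = volterra \<alpha> K h a"
proof -
  have "a - linepath \<alpha> a t = of_real (1 - t) * (a - \<alpha>)"
    and "linepath \<alpha> a t = \<alpha> + of_real t * (a - \<alpha>)" for t
    by (auto simp: linepath_def scaleR_conv_of_real algebra_simps)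
  then show ?thesis
    unfolding volterra_def integral_greaterThanAtMost_eq
    by (simp add: contour_integral_integral volterra_integrand_def[abs_def] del: integral_mult_left)
qed

lemma volterra_add:
  assumes "volterra_integrand \<alpha> K f a integrable_on {0<..1}"
    and "volterra_integrand \<alpha> K g a integrable_on {0<..1}"
  shows "volterra \<alpha> K (\<lambda>z. f z + g z) a = volterra \<alpha> K f a + volterra \<alpha> K g a"
proof -
  have "volterra_integrand \<alpha> K (\<lambda>z. f z + g z) a =
      (\<lambda>t. volterra_integrand \<alpha> K f a t + volterra_integrand \<alpha> K g a t)"
    by (auto simp: volterra_integrand_def algebra_simps)
  then show ?thesis
    using assms by (simp add: volterra_def integral_add)
qed

lemma volterra_cmult:
  "volterra \<alpha> K (\<lambda>z. c * f z) a = c * volterra \<alpha> K f a"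
proof -
  have "volterra_integrand \<alpha> K (\<lambda>z. c * f z) a = (\<lambda>t. c * volterra_integrand \<alpha> K f a t)"
    by (auto simp: volterra_integrand_def algebra_simps)
  then show ?thesis by (simp add: volterra_def)
qed

lemma volterra_integrable_cmult:
  assumes "volterra_integrand \<alpha> K f a integrable_on {0<..1}"
  shows "volterra_integrand \<alpha> K (\<lambda>z. c * f z) a integrable_on {0<..1}"
proof -
  have "volterra_integrand \<alpha> K (\<lambda>z. c * f z) a = (\<lambda>t. c * volterra_integrand \<alpha> K f a t)"
    by (auto simp: volterra_integrand_def algebra_simps)
  then show ?thesis using integrable_on_mult_right[OF assms] by simp
qed

text \<open>Continuity on the half-open interval yields measurability, and the power majorant then
  yields absolute integrability even if \<open>F\<close> is unbounded at 0. The length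
  \<open>e\<close> is a parameter because short intervals measure the truncation error in
  \<open>volterra_holomorphic\<close>.\<close>

lemma integrable_of_powr_bound:
  fixes F :: "real \<Rightarrow> complex"
  assumes "continuous_on {0<..e} F" and "\<And>t. 0 < t \<Longrightarrow> t \<le> e \<Longrightarrow> cmod (F t) \<le> D * t powr \<sigma>"
    and "\<sigma> > - 1" "e \<ge> 0"
  shows "F integrable_on {0<..e}"
    and "cmod (integral {0<..e} F) \<le> D * (e powr (\<sigma> + 1) / (\<sigma> + 1))"
proof -
  have "((\<lambda>t. D * t powr \<sigma>) has_integral (D * (e powr (\<sigma> + 1) / (\<sigma> + 1)))) {0..e}"
    using assms(3,4) by (intro has_integral_mult_right has_integral_powr_from_0) auto
  then have D: "((\<lambda>t. D * t powr \<sigma>) has_integral (D * (e powr (\<sigma> + 1) / (\<sigma> + 1)))) {0<..e}"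
    by (simp add: has_integral_greaterThanAtMost_iff)
  have "F \<in> borel_measurable (lebesgue_on {0<..e})"
    using assms(1) by (intro continuous_imp_measurable_on_sets_lebesgue) auto
  then show *: "F integrable_on {0<..e}"
    by (rule measurable_bounded_by_integrable_imp_integrable[OF _ has_integral_integrable[OF D]])
      (use assms(2) in auto)
  have "cmod (integral {0<..e} F) \<le> integral {0<..e} (\<lambda>t. D * t powr \<sigma>)"
    using assms(2) D by (intro integral_norm_bound_integral *) auto
  then show "cmod (integral {0<..e} F) \<le> D * (e powr (\<sigma> + 1) / (\<sigma> + 1))"
    unfolding integral_unique[OF D] .
qed

section \<open>Integrals from the centre of a star-shaped domain that excludes the centre\<close>

locale punctured_star =
  fixes \<alpha> :: complex and \<Omega> :: "complex set"
  assumes open_dom: "open \<Omega>" and star: "star_shaped_around \<alpha> \<Omega>" and center: "\<alpha> \<notin> \<Omega>"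
begin

lemma segment_in: "a \<in> \<Omega> \<Longrightarrow> 0 < t \<Longrightarrow> t \<le> 1 \<Longrightarrow> \<alpha> + of_real t * (a - \<alpha>) \<in> \<Omega>"
  using star by (auto simp: star_shaped_around_def)

lemma norm_pos: "a \<in> \<Omega> \<Longrightarrow> cmod (a - \<alpha>) > 0"
  using center by auto

lemma continuous_volterra_integrand:
  assumes "continuous_on UNIV K" "continuous_on \<Omega> h" "a \<in> \<Omega>"
  shows "continuous_on {0<..1} (volterra_integrand \<alpha> K h a)"
proof -
  have "continuous_on {0<..1} (\<lambda>t. K (of_real (1 - t) * (a - \<alpha>)))"
    by (rule continuous_on_compose2[OF assms(1)]) (auto intro!: continuous_intros)
  moreover have "continuous_on {0<..1} (\<lambda>t. h (\<alpha> + of_real t * (a - \<alpha>)))"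
    using segment_in[OF assms(3)]
    by (intro continuous_on_compose2[OF assms(2)] continuous_intros) auto
  ultimately show ?thesis
    unfolding volterra_integrand_def by (intro continuous_intros)
qed

text \<open>The growth of the kernel over the part \<open>1 - t\<close> of the segment and that of
  \<open>h\<close> over the part \<open>t\<close> combine to
  \<open>exp (B * r) * exp ((\<Lambda> - B) * r * t)\<close>. Bounding this by its value at
  \<open>t = 1\<close> and integrating the power gains \<open>r / (\<sigma> + 1)\<close>; bounding
  the power by its value at \<open>t = 1\<close> and integrating the exponential gains
  \<open>1 / (\<Lambda> - B)\<close>. The hypotheses concern only the segment to \<open>a\<close>,
  so that \<open>N\<close> and \<open>M\<close> may depend on \<open>a\<close>.\<close>

lemma volterra_estimate:
  assumes K: "continuous_on UNIV K" and h: "continuous_on \<Omega> h" and a: "a \<in> \<Omega>"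
    and N: "N \<ge> 0" "\<And>u. cmod u \<le> cmod (a - \<alpha>) \<Longrightarrow> cmod (K u) \<le> N * exp (B * cmod u)"
    and M: "M \<ge> 0" "\<And>t. 0 < t \<Longrightarrow> t \<le> 1 \<Longrightarrow> cmod (h (\<alpha> + of_real t * (a - \<alpha>))) \<le>
            M * (t * cmod (a - \<alpha>)) powr \<sigma> * exp (\<Lambda> * (t * cmod (a - \<alpha>)))"
    and "\<sigma> > - 1" "B < \<Lambda>"
  shows "volterra_integrand \<alpha> K h a integrable_on {0<..1}"
    and "cmod (volterra \<alpha> K h a) \<le>
      N * M * cmod (a - \<alpha>) powr (\<sigma> + 1) * exp (\<Lambda> * cmod (a - \<alpha>)) / (\<sigma> + 1)"
    and "\<sigma> \<ge> 0 \<Longrightarrow> cmod (volterra \<alpha> K h a) \<le>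
      N * M * cmod (a - \<alpha>) powr \<sigma> * exp (\<Lambda> * cmod (a - \<alpha>)) / (\<Lambda> - B)"
proof -
  define r where "r = cmod (a - \<alpha>)"
  have r: "r > 0" using norm_pos[OF a] by (simp add: r_def)
  let ?F = "volterra_integrand \<alpha> K h a"
  have F: "cmod (?F t) \<le> N * M * r powr \<sigma> * t powr \<sigma> * exp (B * r) * (r * exp ((\<Lambda> - B) * r * t))"
    if t: "0 < t" "t \<le> 1" for t
  proof -
    have nu: "cmod (of_real (1 - t) * (a - \<alpha>)) = (1 - t) * r"
      using t by (simp add: norm_mult r_def del: of_real_diff)
    have le: "(1 - t) * r \<le> r" using t r by (simp add: mult_left_le_one_le)
    have "cmod (?F t) \<le> (N * exp (B * ((1 - t) * r))) * (M * (t * r) powr \<sigma> * exp (\<Lambda> * (t * r))) * r"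
      unfolding volterra_integrand_def norm_mult r_def[symmetric]
      using N(2)[of "of_real (1 - t) * (a - \<alpha>)"] M(2)[OF t] N(1) M(1) r nu le
      by (intro mult_mono) (auto simp: r_def[symmetric] norm_mult)
    also have "\<dots> = N * M * (t * r) powr \<sigma> * (exp (B * ((1 - t) * r)) * exp (\<Lambda> * (t * r))) * r"
      by simp
    also have "exp (B * ((1 - t) * r)) * exp (\<Lambda> * (t * r)) = exp (B * r) * exp ((\<Lambda> - B) * r * t)"
      by (simp add: exp_add[symmetric] algebra_simps)
    finally show ?thesis using t r by (simp add: powr_mult mult_ac)
  qed
  have F1: "cmod (?F t) \<le> (N * M * r powr (\<sigma> + 1) * exp (\<Lambda> * r)) * t powr \<sigma>"
    if t: "0 < t" "t \<le> 1" for t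
  proof -
    have "exp ((\<Lambda> - B) * r * t) \<le> exp ((\<Lambda> - B) * r)"
      using t r \<open>B < \<Lambda>\<close> by (simp add: mult_left_le)
    then have "cmod (?F t) \<le> N * M * r powr \<sigma> * t powr \<sigma> * exp (B * r) * (r * exp ((\<Lambda> - B) * r))"
      using F[OF t] N(1) M(1) r
      by (elim order_trans) (intro mult_left_mono mult_nonneg_nonneg, auto)
    also have "\<dots> = N * M * (r powr \<sigma> * r) * (exp (B * r) * exp ((\<Lambda> - B) * r)) * t powr \<sigma>"
      by simp
    also have "r powr \<sigma> * r = r powr (\<sigma> + 1)" using r by (simp add: powr_add)
    also have "exp (B * r) * exp ((\<Lambda> - B) * r) = exp (\<Lambda> * r)"
      by (simp add: exp_add[symmetric] algebra_simps)
    finally show ?thesis .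
  qed
  note cont = continuous_volterra_integrand[OF K h a]
  show int: "?F integrable_on {0<..1}"
    using integrable_of_powr_bound(1)[OF cont F1 \<open>\<sigma> > - 1\<close>] by simp
  show "cmod (volterra \<alpha> K h a) \<le>
      N * M * cmod (a - \<alpha>) powr (\<sigma> + 1) * exp (\<Lambda> * cmod (a - \<alpha>)) / (\<sigma> + 1)"
    unfolding volterra_def using integrable_of_powr_bound(2)[OF cont F1 \<open>\<sigma> > - 1\<close>] by (simp add: r_def)
  show "cmod (volterra \<alpha> K h a) \<le>
      N * M * cmod (a - \<alpha>) powr \<sigma> * exp (\<Lambda> * cmod (a - \<alpha>)) / (\<Lambda> - B)" if "\<sigma> \<ge> 0"
  proof -
    define D where "D = N * M * r powr \<sigma> * exp (B * r)"
    have D0: "D \<ge> 0" using N(1) M(1) by (simp add: D_def)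
    have F2: "cmod (?F t) \<le> D * (r * exp ((\<Lambda> - B) * r * t))" if t: "t \<in> {0<..1}" for t
    proof -
      have "t powr \<sigma> \<le> 1" using t \<open>\<sigma> \<ge> 0\<close> by (intro powr_le1) auto
      then have "N * M * r powr \<sigma> * t powr \<sigma> * exp (B * r) * (r * exp ((\<Lambda> - B) * r * t)) \<le>
          N * M * r powr \<sigma> * 1 * exp (B * r) * (r * exp ((\<Lambda> - B) * r * t))"
        using N(1) M(1) r by (intro mult_right_mono mult_left_mono mult_nonneg_nonneg) auto
      with F[of t] t show ?thesis by (simp add: D_def)
    qed
    have "((\<lambda>t. D * (r * exp ((\<Lambda> - B) * r * t))) has_integral
        (D * (exp ((\<Lambda> - B) * r * 1) / (\<Lambda> - B)) - D * (exp ((\<Lambda> - B) * r * 0) / (\<Lambda> - B)))) {0..1}"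
    proof (rule fundamental_theorem_of_calculus)
      fix t :: real assume "t \<in> {0..1}"
      have "((\<lambda>t. D * (exp ((\<Lambda> - B) * r * t) / (\<Lambda> - B))) has_real_derivative
          D * (r * exp ((\<Lambda> - B) * r * t))) (at t within {0..1})"
        using \<open>B < \<Lambda>\<close> by (auto intro!: derivative_eq_intros)
      then show "((\<lambda>t. D * (exp ((\<Lambda> - B) * r * t) / (\<Lambda> - B))) has_vector_derivative
          D * (r * exp ((\<Lambda> - B) * r * t))) (at t within {0..1})"
        by (simp add: has_real_derivative_iff_has_vector_derivative)
    qed simp
    then have I: "((\<lambda>t. D * (r * exp ((\<Lambda> - B) * r * t))) has_integral
        (D * (exp ((\<Lambda> - B) * r) / (\<Lambda> - B)) - D * (1 / (\<Lambda> - B)))) {0<..1}"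
      by (simp add: has_integral_greaterThanAtMost_iff)
    have "cmod (volterra \<alpha> K h a) \<le> integral {0<..1} (\<lambda>t. D * (r * exp ((\<Lambda> - B) * r * t)))"
      unfolding volterra_def using F2 I by (intro integral_norm_bound_integral int) auto
    also have "\<dots> = D * (exp ((\<Lambda> - B) * r) / (\<Lambda> - B)) - D * (1 / (\<Lambda> - B))"
      using I by (rule integral_unique)
    also have "\<dots> \<le> D * (exp ((\<Lambda> - B) * r) / (\<Lambda> - B))"
      using D0 \<open>B < \<Lambda>\<close> by simp
    also have "\<dots> = N * M * r powr \<sigma> * (exp (B * r) * exp ((\<Lambda> - B) * r)) / (\<Lambda> - B)"
      by (simp add: D_def)
    also have "exp (B * r) * exp ((\<Lambda> - B) * r) = exp (\<Lambda> * r)"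
      by (simp add: exp_add[symmetric] algebra_simps)
    finally show ?thesis by (simp add: r_def)
  qed
qed

text \<open>Truncation at parameter \<open>1 / (n + 1)\<close> gives proper integrals, holomorphic
  by differentiation under the integral sign. The discarded pieces are bounded by a multiple of
  \<open>(1 / (n + 1)) powr (\<sigma> + 1)\<close>, uniformly for \<open>a\<close> in a closed disc,
  and this tends to 0 because \<open>\<sigma> + 1 > 0\<close>.\<close>

lemma volterra_holomorphic:
  assumes K: "K holomorphic_on UNIV" and h: "h holomorphic_on \<Omega>"
    and M: "M \<ge> 0" "\<And>z. z \<in> \<Omega> \<Longrightarrow> cmod (h z) \<le> M * cmod (z - \<alpha>) powr \<sigma> * exp (\<Lambda> * cmod (z - \<alpha>))"
    and "\<sigma> > - 1"
  shows "volterra \<alpha> K h holomorphic_on \<Omega>"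
proof (rule holomorphic_uniform_sequence[OF open_dom])
  note contK = holomorphic_on_imp_continuous_on[OF K]
  note conth = holomorphic_on_imp_continuous_on[OF h]
  let ?F = "volterra_integrand \<alpha> K h"
  let ?e = "\<lambda>n. 1 / real (Suc n)"
  let ?S = "\<lambda>n a. integral {?e n..1} (?F a)"
  have e01: "0 < ?e n" "?e n \<le> 1" for n by auto
  show "?S n holomorphic_on \<Omega>" for n
  proof -
    let ?I = "cbox (?e n) 1"
    have tI: "0 < t" "t \<le> 1" if "t \<in> ?I" for t
      using that less_le_trans[OF e01(1)[of n]] by auto
    have I_sub: "?I \<subseteq> {0<..1}" using tI by (meson greaterThanAtMost_iff subsetI)
    define dF where "dF = (\<lambda>a t.
        (deriv K (of_real (1 - t) * (a - \<alpha>)) * of_real (1 - t) * h (\<alpha> + of_real t * (a - \<alpha>)) +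
         K (of_real (1 - t) * (a - \<alpha>)) * (deriv h (\<alpha> + of_real t * (a - \<alpha>)) * of_real t)) * (a - \<alpha>) +
         K (of_real (1 - t) * (a - \<alpha>)) * h (\<alpha> + of_real t * (a - \<alpha>)))"
    have D: "((\<lambda>a. ?F a t) has_field_derivative dF a t) (at a within U)"
      if "a \<in> \<Omega>" "t \<in> ?I" for a t U
    proof -
      have 1: "((\<lambda>a. K (of_real (1 - t) * (a - \<alpha>))) has_field_derivative
          deriv K (of_real (1 - t) * (a - \<alpha>)) * of_real (1 - t)) (at a)"
        by (rule DERIV_chain2[OF holomorphic_derivI[OF K open_UNIV]])
          (auto intro!: derivative_eq_intros)
      have 2: "((\<lambda>a. h (\<alpha> + of_real t * (a - \<alpha>))) has_field_derivative
          deriv h (\<alpha> + of_real t * (a - \<alpha>)) * of_real t) (at a)"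
        by (rule DERIV_chain2[OF holomorphic_derivI[OF h open_dom]])
          (use segment_in[OF that(1) tI[OF that(2)]] in \<open>auto intro!: derivative_eq_intros\<close>)
      have 3: "((\<lambda>a. a - \<alpha>) has_field_derivative 1) (at a)"
        by (auto intro!: derivative_eq_intros)
      show ?thesis
        unfolding volterra_integrand_def dF_def
        by (rule has_field_derivative_at_within)
          (use DERIV_mult[OF DERIV_mult[OF 1 2] 3] in \<open>simp add: algebra_simps\<close>)
    qed
    \<comment> \<open>The Leibniz rule for holomorphic integrands wants a convex domain, so it is
      applied on discs; holomorphy is local.\<close>
    have "\<exists>d>0. ball x d \<subseteq> \<Omega>" if "x \<in> \<Omega>" for x
      using open_dom that open_contains_ball by blast
    moreover have "?S n holomorphic_on ball x d" if "ball x d \<subseteq> \<Omega>" for x d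
    proof -
      let ?U = "ball x d"
      have "(\<lambda>a. integral ?I (?F a)) holomorphic_on ?U"
      proof (rule leibniz_rule_holomorphic[of ?U _ _ "?F" dF])
        show "((\<lambda>a. ?F a t) has_field_derivative dF a t) (at a within ?U)" if "a \<in> ?U" "t \<in> ?I" for a t
          by (rule D[OF _ that(2)]) (rule subsetD[OF \<open>?U \<subseteq> \<Omega>\<close> that(1)])
        show "?F a integrable_on ?I" if "a \<in> ?U" for a
        proof (rule integrable_continuous)
          show "continuous_on ?I (?F a)"
            by (rule continuous_on_subset[OF continuous_volterra_integrand[OF contK conth
                    subsetD[OF \<open>?U \<subseteq> \<Omega>\<close> that]] I_sub])
        qed
        have cont_u: "continuous_on (?U \<times> ?I) (\<lambda>y. g (of_real (1 - snd y) * (fst y - \<alpha>)))"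
          if "continuous_on UNIV g" for g :: "complex \<Rightarrow> complex"
          by (intro continuous_on_compose2[OF that] continuous_intros) auto
        have cont_z: "continuous_on (?U \<times> ?I) (\<lambda>y. g (\<alpha> + of_real (snd y) * (fst y - \<alpha>)))"
          if "continuous_on \<Omega> g" for g :: "complex \<Rightarrow> complex"
        proof (rule continuous_on_compose2[OF that])
          show "continuous_on (?U \<times> ?I) (\<lambda>y. \<alpha> + of_real (snd y) * (fst y - \<alpha>))"
            by (intro continuous_intros)
          have "\<alpha> + of_real (snd y) * (fst y - \<alpha>) \<in> \<Omega>" if "y \<in> ?U \<times> ?I" for y
            using that by (intro segment_in tI subsetD[OF \<open>?U \<subseteq> \<Omega>\<close>]) (simp_all add: mem_Times_iff)
          then show "(\<lambda>y. \<alpha> + of_real (snd y) * (fst y - \<alpha>)) ` (?U \<times> ?I) \<subseteq> \<Omega>"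
            by (rule image_subsetI)
        qed
        note cK' = holomorphic_on_imp_continuous_on[OF holomorphic_deriv[OF K open_UNIV]]
        note ch' = holomorphic_on_imp_continuous_on[OF holomorphic_deriv[OF h open_dom]]
        show "continuous_on (?U \<times> ?I) (\<lambda>(a, t). dF a t)"
          unfolding dF_def case_prod_beta
          by (intro continuous_intros cont_u[OF contK] cont_u[OF cK'] cont_z[OF conth] cont_z[OF ch'])
      qed auto
      then show ?thesis by simp
    qed
    ultimately show ?thesis
      using open_dom by (metis analytic_on_def analytic_on_open)
  qed
  fix x assume "x \<in> \<Omega>"
  then obtain d where d: "d > 0" "cball x d \<subseteq> \<Omega>"
    using open_dom open_contains_cball by blast
  let ?C = "cball x d"
  have pos: "cmod (a - \<alpha>) \<noteq> 0" if "a \<in> ?C" for a using that d norm_pos by fastforce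
  have "compact ((\<lambda>(a, t). K (of_real (1 - t) * (a - \<alpha>))) ` (?C \<times> {0..1::real}))"
    unfolding case_prod_beta
    by (intro compact_continuous_image compact_Times continuous_on_compose2[OF contK] continuous_intros) auto
  then have "bounded ((\<lambda>(a, t). K (of_real (1 - t) * (a - \<alpha>))) ` (?C \<times> {0..1::real}))"
    by (rule compact_imp_bounded)
  then obtain k where "k > 0" and k':
    "\<forall>y\<in>(\<lambda>(a, t). K (of_real (1 - t) * (a - \<alpha>))) ` (?C \<times> {0..1::real}). cmod y \<le> k"
    unfolding bounded_pos by (elim exE conjE)
  have k: "cmod (K (of_real (1 - t) * (a - \<alpha>))) \<le> k" if "a \<in> ?C" "t \<in> {0..1}" for a t
    by (rule bspec[OF k']) (rule image_eqI[of _ _ "(a, t)"], use that in simp_all)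
  \<comment> \<open>The absolute value of \<Lambda> makes the exponential increase with the radius,
    so its value at \<open>a\<close> dominates its values along the whole segment.\<close>
  let ?m = "\<lambda>a. M * cmod (a - \<alpha>) powr \<sigma> * exp (\<bar>\<Lambda>\<bar> * cmod (a - \<alpha>)) * cmod (a - \<alpha>)"
  have "continuous_on ?C ?m"
    using pos by (intro continuous_intros) auto
  then have "\<exists>y\<in>?C. \<forall>a\<in>?C. ?m a \<le> ?m y"
    by (intro continuous_attains_sup compact_cball) (use d(1) in auto)
  then obtain m where m: "\<And>a. a \<in> ?C \<Longrightarrow> ?m a \<le> m" by blast
  define D where "D = k * m"
  have bound: "cmod (?F a t) \<le> D * t powr \<sigma>" if "a \<in> ?C" "0 < t" "t \<le> 1" for a t
  proof -
    let ?r = "cmod (a - \<alpha>)"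
    have "a \<in> \<Omega>" using that d by auto
    have nz: "cmod (\<alpha> + of_real t * (a - \<alpha>) - \<alpha>) = t * ?r"
      using that by (simp add: norm_mult)
    have "\<Lambda> * (t * ?r) \<le> \<bar>\<Lambda>\<bar> * (1 * ?r)"
      using that by (intro mult_mono) auto
    then have "cmod (h (\<alpha> + of_real t * (a - \<alpha>))) \<le> M * (t * ?r) powr \<sigma> * exp (\<bar>\<Lambda>\<bar> * ?r)"
      using M(2)[OF segment_in[OF \<open>a \<in> \<Omega>\<close> that(2,3)]] M(1) unfolding nz
      by (elim order_trans) (intro mult_left_mono, auto)
    then have "cmod (?F a t) \<le> k * (M * (t * ?r) powr \<sigma> * exp (\<bar>\<Lambda>\<bar> * ?r)) * ?r"
      unfolding volterra_integrand_def norm_mult[of "_ * _" "a - \<alpha>"] norm_mult[of "K _"]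
      using k[of a t] \<open>k > 0\<close> that M(1) by (intro mult_mono mult_nonneg_nonneg) auto
    also have "\<dots> = k * ?m a * t powr \<sigma>"
      using that by (simp add: powr_mult)
    also have "\<dots> \<le> D * t powr \<sigma>"
      unfolding D_def using m[OF that(1)] \<open>k > 0\<close> by (intro mult_right_mono mult_left_mono) auto
    finally show ?thesis .
  qed
  have int: "?F a integrable_on {0<..1}" if "a \<in> ?C" for a
    by (rule integrable_of_powr_bound(1)[OF continuous_volterra_integrand[OF contK conth] bound])
      (use that d \<open>\<sigma> > - 1\<close> in auto)
  have diff: "cmod (?S n a - volterra \<alpha> K h a) \<le> D * (?e n powr (\<sigma> + 1) / (\<sigma> + 1))" if "a \<in> ?C" for n a
  proof -
    have int': "?F a integrable_on {0..1}"
      using int[OF that] by (simp add: integrable_greaterThanAtMost_iff)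
    have "volterra \<alpha> K h a - ?S n a = integral {0..?e n} (?F a)"
      unfolding volterra_def integral_greaterThanAtMost_eq
      using Henstock_Kurzweil_Integration.integral_combine[OF _ _ int', of "?e n"] e01[of n] by (simp add: algebra_simps)
    also have "\<dots> = integral {0<..?e n} (?F a)"
      by (rule integral_greaterThanAtMost_eq[symmetric])
    also have "cmod \<dots> \<le> D * (?e n powr (\<sigma> + 1) / (\<sigma> + 1))"
    proof (rule integrable_of_powr_bound(2)[OF _ _ \<open>\<sigma> > - 1\<close>])
      show "continuous_on {0<..?e n} (?F a)"
        by (rule continuous_on_subset[OF continuous_volterra_integrand[OF contK conth
                subsetD[OF d(2) that]]]) (use order_trans[OF _ e01(2)[of n]] in \<open>auto simp del: of_nat_Suc\<close>)
      show "cmod (?F a t) \<le> D * t powr \<sigma>" if "0 < t" "t \<le> ?e n" for t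
        using bound[OF \<open>a \<in> ?C\<close> that(1) order_trans[OF that(2) e01(2)]] .
    qed auto
    finally show ?thesis by (simp add: norm_minus_commute)
  qed
  have "(\<lambda>n. D * (?e n powr (\<sigma> + 1) / (\<sigma> + 1))) \<longlonglongrightarrow> D * (0 powr (\<sigma> + 1) / (\<sigma> + 1))"
    using \<open>\<sigma> > - 1\<close> LIMSEQ_Suc[OF lim_inverse_n']
    by (intro tendsto_intros tendsto_powr2) auto
  then have lim: "(\<lambda>n. D * (?e n powr (\<sigma> + 1) / (\<sigma> + 1))) \<longlonglongrightarrow> 0" by simp
  have "uniform_limit ?C ?S (volterra \<alpha> K h) sequentially"
  proof (rule uniform_limitI)
    fix e :: real assume "e > 0"
    then have "\<forall>\<^sub>F n in sequentially. D * (?e n powr (\<sigma> + 1) / (\<sigma> + 1)) < e"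
      using order_tendstoD(2)[OF lim] by blast
    then show "\<forall>\<^sub>F n in sequentially. \<forall>a\<in>?C. dist (?S n a) (volterra \<alpha> K h a) < e"
    proof (rule eventually_mono)
      fix n assume *: "D * (?e n powr (\<sigma> + 1) / (\<sigma> + 1)) < e"
      show "\<forall>a\<in>?C. dist (?S n a) (volterra \<alpha> K h a) < e"
        unfolding dist_norm using le_less_trans[OF diff *] by blast
    qed
  qed
  then show "\<exists>d>0. cball x d \<subseteq> \<Omega> \<and> uniform_limit (cball x d) ?S (volterra \<alpha> K h) sequentially"
    by (intro exI[of _ d] conjI d)
qed

section \<open>The weighted spaces and the power\<close>

lemma mem_HL_inf_iff:
  "f \<in> HL_inf \<sigma> \<Lambda> \<alpha> \<Omega> \<longleftrightarrow> f holomorphic_on \<Omega> \<and>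
     (\<exists>M\<ge>0. \<forall>z\<in>\<Omega>. cmod (f z) \<le> M * (cmod (z - \<alpha>) powr \<sigma> * exp (\<Lambda> * cmod (z - \<alpha>))))"
proof -
  have eq: "cmod (z - \<alpha>) powr (- \<sigma>) * exp (- \<Lambda> * cmod (z - \<alpha>)) * cmod (f z) \<le> M \<longleftrightarrow>
      cmod (f z) \<le> M * (cmod (z - \<alpha>) powr \<sigma> * exp (\<Lambda> * cmod (z - \<alpha>)))" if "z \<in> \<Omega>" for z M
    using norm_pos[OF that] by (simp add: powr_minus exp_minus field_simps)
  have "(\<exists>M. \<forall>z\<in>\<Omega>. cmod (f z) \<le> M * (cmod (z - \<alpha>) powr \<sigma> * exp (\<Lambda> * cmod (z - \<alpha>)))) \<longleftrightarrow>
     (\<exists>M\<ge>0. \<forall>z\<in>\<Omega>. cmod (f z) \<le> M * (cmod (z - \<alpha>) powr \<sigma> * exp (\<Lambda> * cmod (z - \<alpha>))))"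
    (is "?l \<longleftrightarrow> ?r")
  proof
    assume ?l
    then obtain M where M: "\<forall>z\<in>\<Omega>. cmod (f z) \<le> M * (cmod (z - \<alpha>) powr \<sigma> * exp (\<Lambda> * cmod (z - \<alpha>)))"
      by blast
    have "cmod (f z) \<le> \<bar>M\<bar> * (cmod (z - \<alpha>) powr \<sigma> * exp (\<Lambda> * cmod (z - \<alpha>)))" if "z \<in> \<Omega>" for z
      using M that by (elim ballE[of _ _ z] order_trans) (auto intro!: mult_right_mono)
    then show ?r by (intro exI[of _ "\<bar>M\<bar>"]) auto
  qed blast
  then show ?thesis
    using eq by (simp add: HL_inf_def bdd_above_def)
qed

lemma HL_inf_mono:
  assumes "f \<in> HL_inf \<sigma> \<Lambda> \<alpha> \<Omega>" "\<Lambda> \<le> \<Lambda>'"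
  shows "f \<in> HL_inf \<sigma> \<Lambda>' \<alpha> \<Omega>"
proof -
  obtain M where M: "M \<ge> 0" "f holomorphic_on \<Omega>"
      "\<forall>z\<in>\<Omega>. cmod (f z) \<le> M * (cmod (z - \<alpha>) powr \<sigma> * exp (\<Lambda> * cmod (z - \<alpha>)))"
    using assms(1) unfolding mem_HL_inf_iff by blast
  have "cmod (f z) \<le> M * (cmod (z - \<alpha>) powr \<sigma> * exp (\<Lambda>' * cmod (z - \<alpha>)))" if "z \<in> \<Omega>" for z
    using M assms(2) that
    by (elim ballE[of _ _ z] order_trans) (auto intro!: mult_left_mono mult_right_mono)
  with M show ?thesis unfolding mem_HL_inf_iff by blast
qed

lemma HL_inf_add:
  assumes "f \<in> HL_inf \<sigma> \<Lambda> \<alpha> \<Omega>" "g \<in> HL_inf \<sigma> \<Lambda> \<alpha> \<Omega>"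
  shows "(\<lambda>z. f z + g z) \<in> HL_inf \<sigma> \<Lambda> \<alpha> \<Omega>"
proof -
  obtain M where M: "M \<ge> 0" "f holomorphic_on \<Omega>"
      "\<forall>z\<in>\<Omega>. cmod (f z) \<le> M * (cmod (z - \<alpha>) powr \<sigma> * exp (\<Lambda> * cmod (z - \<alpha>)))"
    using assms(1) unfolding mem_HL_inf_iff by blast
  obtain M' where M': "M' \<ge> 0" "g holomorphic_on \<Omega>"
      "\<forall>z\<in>\<Omega>. cmod (g z) \<le> M' * (cmod (z - \<alpha>) powr \<sigma> * exp (\<Lambda> * cmod (z - \<alpha>)))"
    using assms(2) unfolding mem_HL_inf_iff by blast
  have "cmod (f z + g z) \<le> (M + M') * (cmod (z - \<alpha>) powr \<sigma> * exp (\<Lambda> * cmod (z - \<alpha>)))"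
    if "z \<in> \<Omega>" for z
    using norm_triangle_ineq[of "f z" "g z"] M(3) M'(3) that by (fastforce simp: distrib_right)
  with M M' show ?thesis
    unfolding mem_HL_inf_iff by (intro conjI holomorphic_intros exI[of _ "M + M'"]) auto
qed

lemma HL_inf_diff:
  assumes "f \<in> HL_inf \<sigma> \<Lambda> \<alpha> \<Omega>" "g \<in> HL_inf \<sigma> \<Lambda> \<alpha> \<Omega>"
  shows "(\<lambda>z. f z - g z) \<in> HL_inf \<sigma> \<Lambda> \<alpha> \<Omega>"
proof -
  obtain M where "M \<ge> 0" "g holomorphic_on \<Omega>"
      "\<forall>z\<in>\<Omega>. cmod (g z) \<le> M * (cmod (z - \<alpha>) powr \<sigma> * exp (\<Lambda> * cmod (z - \<alpha>)))"
    using assms(2) unfolding mem_HL_inf_iff by blast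
  then have "(\<lambda>z. - g z) \<in> HL_inf \<sigma> \<Lambda> \<alpha> \<Omega>"
    unfolding mem_HL_inf_iff by (auto intro!: holomorphic_intros)
  from HL_inf_add[OF assms(1) this] show ?thesis by simp
qed

text \<open>At infinity a higher power is not dominated by a lower one. The surplus factor
  \<open>r\<close> is absorbed by \<open>exp r\<close>, which raises the exponential type by
  1.\<close>

lemma HL_inf_shift_exponent:
  assumes "f \<in> HL_inf (\<sigma> + 1) \<Lambda> \<alpha> \<Omega>"
  shows "f \<in> HL_inf \<sigma> (\<Lambda> + 1) \<alpha> \<Omega>"
proof -
  obtain M where M: "M \<ge> 0" "f holomorphic_on \<Omega>"
      "\<forall>z\<in>\<Omega>. cmod (f z) \<le> M * (cmod (z - \<alpha>) powr (\<sigma> + 1) * exp (\<Lambda> * cmod (z - \<alpha>)))"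
    using assms(1) unfolding mem_HL_inf_iff by blast
  have "cmod (f z) \<le> M * (cmod (z - \<alpha>) powr \<sigma> * exp ((\<Lambda> + 1) * cmod (z - \<alpha>)))" if z: "z \<in> \<Omega>" for z
  proof -
    let ?r = "cmod (z - \<alpha>)"
    have "?r powr (\<sigma> + 1) * exp (\<Lambda> * ?r) = ?r powr \<sigma> * (?r * exp (\<Lambda> * ?r))"
      using norm_pos[OF z] by (simp add: powr_add)
    also have "\<dots> \<le> ?r powr \<sigma> * (exp ?r * exp (\<Lambda> * ?r))"
      using order_trans[OF _ exp_ge_add_one_self[of ?r]] by (intro mult_left_mono mult_right_mono) auto
    also have "exp ?r * exp (\<Lambda> * ?r) = exp ((\<Lambda> + 1) * ?r)"
      by (simp add: exp_add[symmetric] algebra_simps)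
    finally show ?thesis
      using M(3) z mult_left_mono[OF _ M(1)] by (meson order_trans)
  qed
  with M show ?thesis unfolding mem_HL_inf_iff by blast
qed

text \<open>The differential equation for \<open>b\<close> makes
  \<open>(z - \<alpha>) * b z / \<tau>\<close> a primitive of \<open>b\<close>. It tends to 0 at
  \<alpha> along the segment because its modulus is \<open>r powr \<tau> / \<tau>\<close> with
  \<open>\<tau> > 0\<close>, so no boundary term remains.\<close>

lemma volterra_power:
  assumes "\<tau> > 0" and b: "\<And>z. z \<in> \<Omega> \<Longrightarrow> (b has_field_derivative of_real (\<tau> - 1) / (z - \<alpha>) * b z) (at z)"
    and nb: "\<And>z. z \<in> \<Omega> \<Longrightarrow> cmod (b z) = cmod (z - \<alpha>) powr (\<tau> - 1)" and a: "a \<in> \<Omega>"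
  shows "volterra \<alpha> (\<lambda>_. 1) b a = (a - \<alpha>) * b a / of_real \<tau>"
proof -
  define G where "G = (\<lambda>z. (z - \<alpha>) * b z / of_real \<tau>)"
  define s where "s = (\<lambda>t. \<alpha> + of_real t * (a - \<alpha>))"
  have s: "s t \<in> \<Omega>" if "0 < t" "t \<le> 1" for t using segment_in[OF a that] by (simp add: s_def)
  have dG: "(G has_field_derivative b z) (at z)" if "z \<in> \<Omega>" for z
  proof -
    have "z - \<alpha> \<noteq> 0" using that center by auto
    then have "of_real (\<tau> - 1) / (z - \<alpha>) * b z * (z - \<alpha>) = of_real (\<tau> - 1) * b z"
      by simp
    then have eq: "(1 * b z + of_real (\<tau> - 1) / (z - \<alpha>) * b z * (z - \<alpha>)) / of_real \<tau> = b z"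
      using \<open>\<tau> > 0\<close> by (simp add: field_simps)
    have "((\<lambda>z. z - \<alpha>) has_field_derivative 1) (at z)"
      by (auto intro!: derivative_eq_intros)
    from DERIV_cdivide[OF DERIV_mult[OF this b[OF that]], of "of_real \<tau>"] show ?thesis
      unfolding eq G_def .
  qed
  have ds: "(s has_vector_derivative (a - \<alpha>)) (at t)" for t
    unfolding s_def by (auto intro!: derivative_eq_intros)
  have dGs: "((G \<circ> s) has_vector_derivative (a - \<alpha>) * b (s t)) (at t)" if "0 < t" "t \<le> 1" for t
    by (rule field_vector_diff_chain_at[OF ds dG[OF s[OF that]]])
  have "((\<lambda>t. (a - \<alpha>) * b (s t)) has_integral ((G \<circ> s) 1 - (G \<circ> s) 0)) {0..1}"
  \<comment> \<open>Differentiability may fail at parameter 0, so the version that asks only for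
    continuity at the endpoints is used.\<close>
  proof (rule fundamental_theorem_of_calculus_interior)
    show "continuous_on {0..1} (G \<circ> s)"
      unfolding continuous_on_eq_continuous_within
    proof
      fix t :: real assume t: "t \<in> {0..1}"
      show "continuous (at t within {0..1}) (G \<circ> s)"
      proof (cases "t = 0")
        \<comment> \<open>The factor \<open>z - \<alpha>\<close> gives \<open>G\<close> the value 0
          at \<alpha>, whatever junk value \<open>b\<close> has there.\<close>
        case True
        have "((\<lambda>t. (t * cmod (a - \<alpha>)) powr \<tau> / \<tau>) \<longlongrightarrow> (0 * cmod (a - \<alpha>)) powr \<tau> / \<tau>) (at 0 within {0..1})"
          using \<open>\<tau> > 0\<close> by (intro tendsto_intros tendsto_powr2) (auto simp: eventually_at_filter)
        then have lim: "((\<lambda>t. (t * cmod (a - \<alpha>)) powr \<tau> / \<tau>) \<longlongrightarrow> 0) (at 0 within {0..1})"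
          using \<open>\<tau> > 0\<close> by simp
        have "cmod ((G \<circ> s) t) \<le> (t * cmod (a - \<alpha>)) powr \<tau> / \<tau>" if "t \<in> {0..1}" "t \<noteq> 0" for t
        proof -
          have "0 < t" "t \<le> 1" using that by auto
          have n: "cmod (s t - \<alpha>) = t * cmod (a - \<alpha>)"
            using \<open>0 < t\<close> by (simp add: s_def norm_mult)
          then show ?thesis
            using nb[OF s[OF \<open>0 < t\<close> \<open>t \<le> 1\<close>]] \<open>\<tau> > 0\<close> \<open>0 < t\<close> norm_pos[OF a]
            by (simp add: G_def norm_mult norm_divide powr_diff)
        qed
        then have "((G \<circ> s) \<longlongrightarrow> 0) (at 0 within {0..1})"
          by (intro Lim_null_comparison[OF _ lim]) (auto simp: eventually_at_filter)
        then show ?thesis by (simp add: True continuous_within G_def s_def)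
      next
        case False
        with t have "0 < t" "t \<le> 1" by auto
        from dGs[OF this] show ?thesis
          using continuous_at_imp_continuous_at_within has_vector_derivative_continuous by blast
      qed
    qed
  qed (auto intro!: dGs simp del: comp_apply o_apply)
  moreover have "(\<lambda>t. (a - \<alpha>) * b (s t)) = volterra_integrand \<alpha> (\<lambda>_. 1) b a"
    by (simp add: volterra_integrand_def s_def fun_eq_iff)
  ultimately have "integral {0..1} (volterra_integrand \<alpha> (\<lambda>_. 1) b a) = (G \<circ> s) 1 - (G \<circ> s) 0"
    using integral_unique by metis
  then show ?thesis
    by (simp add: volterra_def integral_greaterThanAtMost_eq G_def s_def)
qed

text \<open>These two facts are all that is used of the branch from here on. Differentiating
  \<open>exp (L z) = z - \<alpha>\<close> gives the derivative of the logarithm; since the exponent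
  is real, the modulus involves only the real part of \<open>L\<close> and is the same for all
  branches.\<close>

lemma power_branch_properties:
  assumes "power_branch (of_real (\<tau> - 1)) \<alpha> \<Omega> b" and z: "z \<in> \<Omega>"
  shows "(b has_field_derivative of_real (\<tau> - 1) / (z - \<alpha>) * b z) (at z)"
    and "cmod (b z) = cmod (z - \<alpha>) powr (\<tau> - 1)"
proof -
  obtain L where L: "L holomorphic_on \<Omega>" "\<And>z. z \<in> \<Omega> \<Longrightarrow> exp (L z) = z - \<alpha>"
    "\<And>z. z \<in> \<Omega> \<Longrightarrow> b z = exp (of_real (\<tau> - 1) * L z)"
    using assms unfolding power_branch_def by blast
  have dL: "(L has_field_derivative deriv L z) (at z)"
    using holomorphic_derivI[OF L(1) open_dom z] .
  have "((\<lambda>z. exp (L z)) has_field_derivative exp (L z) * deriv L z) (at z)"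
    using dL by (auto intro!: derivative_eq_intros)
  moreover have "((\<lambda>z. exp (L z)) has_field_derivative 1) (at z)"
    by (rule has_field_derivative_transform_within_open[OF _ open_dom z, of "\<lambda>z. z - \<alpha>"])
      (use L in \<open>auto intro!: derivative_eq_intros\<close>)
  ultimately have "exp (L z) * deriv L z = 1" by (rule DERIV_unique)
  then have L': "deriv L z = 1 / (z - \<alpha>)" using L(2)[OF z] by (metis mult_eq_0_iff nonzero_divide_eq_eq exp_not_eq_zero mult.commute)
  show "(b has_field_derivative of_real (\<tau> - 1) / (z - \<alpha>) * b z) (at z)"
    by (rule has_field_derivative_transform_within_open[OF _ open_dom z,
          of "\<lambda>z. exp (of_real (\<tau> - 1) * L z)"])
      (use L(3) z dL in \<open>auto intro!: derivative_eq_intros simp: L'\<close>)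
  have "cmod (b z) = exp ((\<tau> - 1) * Re (L z))"
    using L(3)[OF z] by (simp del: of_real_diff)
  also have "\<dots> = exp (Re (L z)) powr (\<tau> - 1)" by (simp add: powr_def)
  also have "exp (Re (L z)) = cmod (z - \<alpha>)" using L(2)[OF z] by (metis norm_exp_eq_Re)
  finally show "cmod (b z) = cmod (z - \<alpha>) powr (\<tau> - 1)" .
qed

end

section \<open>The fixed-point operator\<close>

text \<open>In the application \<open>P (- z) = (z - \<alpha>) * p1 z\<close>, \<open>q z = Q (- z)\<close>, \<open>K (a - a') = k\<^sub>R(a, a')\<close> and
  \<open>n = d - 1\<close>.\<close>

locale regular_volterra_equation = punctured_star +
  fixes p1 q K :: "complex \<Rightarrow> complex" and \<tau> c C N B :: real and n :: nat
  assumes hol: "p1 holomorphic_on UNIV" "q holomorphic_on UNIV" "K holomorphic_on UNIV"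
    and constants: "\<tau> > 0" "c > 0" "C \<ge> 0" "N \<ge> 0" "B > 0"
    and p1_lower: "\<And>z. z \<in> \<Omega> \<Longrightarrow> c * (1 + cmod (z - \<alpha>)) ^ n \<le> cmod (p1 z)"
    and p1_incr: "\<And>z. cmod (p1 z - p1 \<alpha>) \<le> C * cmod (z - \<alpha>) * (1 + cmod (z - \<alpha>)) ^ n"
    and q_incr: "\<And>z. cmod (q z - q \<alpha>) \<le> C * cmod (z - \<alpha>) * (1 + cmod (z - \<alpha>)) ^ n"
    and q_center: "q \<alpha> = - of_real \<tau> * p1 \<alpha>"
    and K_bound: "\<And>u. cmod (K u) \<le> N * cmod u * exp (B * cmod u)"
begin

definition T :: "(complex \<Rightarrow> complex) \<Rightarrow> complex \<Rightarrow> complex" where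
  "T f a = - (volterra \<alpha> (\<lambda>_. 1) (\<lambda>z. q z * f z) a + volterra \<alpha> K f a) / ((a - \<alpha>) * p1 a)"

text \<open>The part of the \<open>q\<close> integral left after freezing \<open>q\<close> at
  \<alpha>. Its integrand gains a factor \<open>r\<close>, which offsets the division by
  \<open>a - \<alpha>\<close> in \<open>T\<close>.\<close>

definition remainder :: "(complex \<Rightarrow> complex) \<Rightarrow> complex \<Rightarrow> complex" where
  "remainder f = volterra \<alpha> (\<lambda>_. 1) (\<lambda>z. (q z - q \<alpha>) * f z)"

lemma p1_nz: "a \<in> \<Omega> \<Longrightarrow> p1 a \<noteq> 0"
  using p1_lower[of a] constants(2) by (smt (verit) norm_eq_zero norm_ge_zero mult_pos_pos zero_less_power)

text \<open>Three instances of \<open>volterra_estimate\<close>: kernel 1 with \<open>f\<close>;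
  kernel 1 with the increment of \<open>q\<close> times \<open>f\<close>, which has order
  \<open>\<sigma> + 1\<close>; and kernel \<open>K\<close>. The bounds with denominators
  \<open>\<sigma> + 1\<close> and \<open>\<sigma> + 2\<close> also serve the power, whose order may
  be negative; those with \<Lambda> provide smallness.\<close>

lemma estimates:
  assumes f: "f holomorphic_on \<Omega>" and M: "M \<ge> 0"
      "\<And>z. z \<in> \<Omega> \<Longrightarrow> cmod (f z) \<le> M * (cmod (z - \<alpha>) powr \<sigma> * exp (\<Lambda> * cmod (z - \<alpha>)))"
    and \<sigma>: "\<sigma> > - 1" and \<Lambda>: "\<Lambda> > B" and a: "a \<in> \<Omega>"
  defines "r \<equiv> cmod (a - \<alpha>)"
  shows "volterra_integrand \<alpha> (\<lambda>_. 1) (\<lambda>z. q z * f z) a integrable_on {0<..1}"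
    and "volterra_integrand \<alpha> K f a integrable_on {0<..1}"
    and "volterra \<alpha> (\<lambda>_. 1) (\<lambda>z. q z * f z) a = q \<alpha> * volterra \<alpha> (\<lambda>_. 1) f a + remainder f a"
    and "cmod (volterra \<alpha> (\<lambda>_. 1) f a) \<le> M * r powr (\<sigma> + 1) * exp (\<Lambda> * r) / (\<sigma> + 1)"
    and "\<sigma> \<ge> 0 \<Longrightarrow> cmod (volterra \<alpha> (\<lambda>_. 1) f a) \<le> M * r powr \<sigma> * exp (\<Lambda> * r) / \<Lambda>"
    and "cmod (remainder f a) \<le> C * (1 + r) ^ n * M * r powr (\<sigma> + 2) * exp (\<Lambda> * r) / (\<sigma> + 2)"
    and "cmod (remainder f a) \<le> C * (1 + r) ^ n * M * r powr (\<sigma> + 1) * exp (\<Lambda> * r) / \<Lambda>"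
    and "cmod (volterra \<alpha> K f a) \<le> N * r * M * r powr (\<sigma> + 1) * exp (\<Lambda> * r) / (\<sigma> + 1)"
    and "\<sigma> \<ge> 0 \<Longrightarrow> cmod (volterra \<alpha> K f a) \<le> N * r * M * r powr \<sigma> * exp (\<Lambda> * r) / (\<Lambda> - B)"
proof -
  have r: "r > 0" using norm_pos[OF a] by (simp add: r_def)
  have \<Lambda>0: "\<Lambda> > 0" using \<Lambda> constants by simp
  note cf = holomorphic_on_imp_continuous_on[OF f]
  have cq: "continuous_on \<Omega> (\<lambda>z. q z - q \<alpha>)"
    using holomorphic_on_imp_continuous_on[OF hol(2)] by (intro continuous_intros) (auto intro: continuous_on_subset)
  note cK = holomorphic_on_imp_continuous_on[OF hol(3)]
  have seg: "cmod (\<alpha> + of_real t * (a - \<alpha>) - \<alpha>) = t * r" if "0 < t" for t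
    using that by (simp add: norm_mult r_def)
  have fb: "cmod (f (\<alpha> + of_real t * (a - \<alpha>))) \<le> M * (t * r) powr \<sigma> * exp (\<Lambda> * (t * r))"
    if "0 < t" "t \<le> 1" for t
    using M(2)[OF segment_in[OF a that]] unfolding seg[OF that(1)] by (simp add: mult.assoc)
  have qb: "cmod ((q (\<alpha> + of_real t * (a - \<alpha>)) - q \<alpha>) * f (\<alpha> + of_real t * (a - \<alpha>))) \<le>
      (C * (1 + r) ^ n * M) * (t * r) powr (\<sigma> + 1) * exp (\<Lambda> * (t * r))"
    if t: "0 < t" "t \<le> 1" for t
  proof -
    have "t * r \<le> r" using t r by (simp add: mult_left_le_one_le)
    have "cmod (q (\<alpha> + of_real t * (a - \<alpha>)) - q \<alpha>) \<le> C * (t * r) * (1 + t * r) ^ n"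
      using q_incr[of "\<alpha> + of_real t * (a - \<alpha>)"] unfolding seg[OF t(1)] .
    also have "\<dots> \<le> C * (t * r) * (1 + r) ^ n"
      using \<open>t * r \<le> r\<close> t r constants by (intro mult_left_mono power_mono mult_nonneg_nonneg) auto
    finally have "cmod ((q (\<alpha> + of_real t * (a - \<alpha>)) - q \<alpha>) * f (\<alpha> + of_real t * (a - \<alpha>))) \<le>
        (C * (t * r) * (1 + r) ^ n) * (M * (t * r) powr \<sigma> * exp (\<Lambda> * (t * r)))"
      unfolding norm_mult using fb[OF t] t r constants by (intro mult_mono) auto
    then show ?thesis using t r by (simp add: powr_add mult_ac)
  qed
  note V1 = volterra_estimate[where K = "\<lambda>_. 1" and h = f and N = 1 and B = 0 and M = M
      and \<sigma> = \<sigma> and \<Lambda> = \<Lambda>, OF continuous_on_const cf a _ _ M(1) fb[unfolded r_def] \<sigma> \<Lambda>0, simplified, folded r_def]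
  note VR = volterra_estimate[where K = "\<lambda>_. 1" and h = "\<lambda>z. (q z - q \<alpha>) * f z" and N = 1 and B = 0
      and M = "C * (1 + cmod (a - \<alpha>)) ^ n * M" and \<sigma> = "\<sigma> + 1" and \<Lambda> = \<Lambda>,
      OF continuous_on_const continuous_on_mult[OF cq cf] a _ _ _ qb[unfolded r_def] _ \<Lambda>0, simplified, folded r_def]
  \<comment> \<open>The linear factor in the bound on \<open>K\<close> is at most \<open>r\<close>
    on the segment and becomes part of the constant for this \<open>a\<close>.\<close>
  have Kb: "cmod (K u) \<le> N * r * exp (B * cmod u)" if "cmod u \<le> r" for u
    using that constants by (intro order_trans[OF K_bound] mult_right_mono mult_left_mono) auto
  note VK = volterra_estimate[where K = K and h = f and N = "N * cmod (a - \<alpha>)" and B = B and M = M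
      and \<sigma> = \<sigma> and \<Lambda> = \<Lambda>, OF cK cf a _ Kb[unfolded r_def] M(1) fb[unfolded r_def] \<sigma> \<Lambda>, folded r_def]
  have nonneg: "0 \<le> C * (1 + r) ^ n * M" "0 \<le> N * r" "- 1 < \<sigma> + 1" "0 \<le> \<sigma> + 1"
    using constants r M(1) \<sigma> by auto
  show "cmod (volterra \<alpha> (\<lambda>_. 1) f a) \<le> M * r powr (\<sigma> + 1) * exp (\<Lambda> * r) / (\<sigma> + 1)"
    and "\<sigma> \<ge> 0 \<Longrightarrow> cmod (volterra \<alpha> (\<lambda>_. 1) f a) \<le> M * r powr \<sigma> * exp (\<Lambda> * r) / \<Lambda>"
    using V1 by auto
  show "cmod (remainder f a) \<le> C * (1 + r) ^ n * M * r powr (\<sigma> + 2) * exp (\<Lambda> * r) / (\<sigma> + 2)"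
    and "cmod (remainder f a) \<le> C * (1 + r) ^ n * M * r powr (\<sigma> + 1) * exp (\<Lambda> * r) / \<Lambda>"
    unfolding remainder_def using VR nonneg \<sigma> by (auto simp: add.commute[of \<sigma> 2])
  show "volterra_integrand \<alpha> K f a integrable_on {0<..1}"
    and "cmod (volterra \<alpha> K f a) \<le> N * r * M * r powr (\<sigma> + 1) * exp (\<Lambda> * r) / (\<sigma> + 1)"
    and "\<sigma> \<ge> 0 \<Longrightarrow> cmod (volterra \<alpha> K f a) \<le> N * r * M * r powr \<sigma> * exp (\<Lambda> * r) / (\<Lambda> - B)"
    using VK nonneg by auto
  have I1: "volterra_integrand \<alpha> (\<lambda>_. 1) (\<lambda>z. q \<alpha> * f z) a integrable_on {0<..1}"
    using V1 by (intro volterra_integrable_cmult) auto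
  have I2: "volterra_integrand \<alpha> (\<lambda>_. 1) (\<lambda>z. (q z - q \<alpha>) * f z) a integrable_on {0<..1}"
    using VR nonneg by auto
  have split: "(\<lambda>z. q z * f z) = (\<lambda>z. q \<alpha> * f z + (q z - q \<alpha>) * f z)"
    by (simp add: algebra_simps)
  show "volterra \<alpha> (\<lambda>_. 1) (\<lambda>z. q z * f z) a = q \<alpha> * volterra \<alpha> (\<lambda>_. 1) f a + remainder f a"
    unfolding split volterra_add[OF I1 I2] volterra_cmult remainder_def ..
  have "volterra_integrand \<alpha> (\<lambda>_. 1) (\<lambda>z. q z * f z) a = (\<lambda>t.
      volterra_integrand \<alpha> (\<lambda>_. 1) (\<lambda>z. q \<alpha> * f z) a t +
      volterra_integrand \<alpha> (\<lambda>_. 1) (\<lambda>z. (q z - q \<alpha>) * f z) a t)"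
    by (simp add: volterra_integrand_def algebra_simps fun_eq_iff)
  then show "volterra_integrand \<alpha> (\<lambda>_. 1) (\<lambda>z. q z * f z) a integrable_on {0<..1}"
    using integrable_add[OF I1 I2] by simp
qed

text \<open>A crude bound that trades polynomial growth for exponential type, to fit the hypothesis
  of \<open>volterra_holomorphic\<close>. The larger exponent is harmless there, since holomorphy is
  obtained for every \<Lambda>.\<close>

lemma q_growth:
  assumes "z \<in> \<Omega>"
  shows "cmod (q z) \<le> (cmod (q \<alpha>) + C) * exp (real (n + 1) * cmod (z - \<alpha>))"
proof -
  let ?r = "cmod (z - \<alpha>)"
  have e1: "1 + ?r \<le> exp ?r" "?r \<le> exp ?r"
    using exp_ge_add_one_self[of ?r] order_trans[OF _ exp_ge_add_one_self[of ?r]] by auto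
  have "?r * (1 + ?r) ^ n \<le> exp ?r * exp ?r ^ n"
    using e1 by (intro mult_mono power_mono) auto
  also have "\<dots> = exp (real (n + 1) * ?r)"
    using exp_of_nat_mult[of "n + 1" ?r] by simp
  finally have e2: "?r * (1 + ?r) ^ n \<le> exp (real (n + 1) * ?r)" .
  have "cmod (q z) \<le> cmod (q \<alpha>) + cmod (q z - q \<alpha>)"
    using norm_triangle_ineq[of "q \<alpha>" "q z - q \<alpha>"] by simp
  also have "\<dots> \<le> cmod (q \<alpha>) * 1 + C * (?r * (1 + ?r) ^ n)"
    using q_incr[of z] by (simp add: mult.assoc)
  also have "\<dots> \<le> cmod (q \<alpha>) * exp (real (n + 1) * ?r) + C * exp (real (n + 1) * ?r)"
    using e2 constants by (intro add_mono mult_left_mono) auto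
  finally show ?thesis by (simp add: distrib_right)
qed

lemma T_holomorphic:
  assumes f: "f holomorphic_on \<Omega>" and M: "M \<ge> 0"
      "\<And>z. z \<in> \<Omega> \<Longrightarrow> cmod (f z) \<le> M * (cmod (z - \<alpha>) powr \<sigma> * exp (\<Lambda> * cmod (z - \<alpha>)))"
    and \<sigma>: "\<sigma> > - 1"
  shows "T f holomorphic_on \<Omega>"
proof -
  have on: "q holomorphic_on \<Omega>" "p1 holomorphic_on \<Omega>"
    using hol by (auto intro: holomorphic_on_subset)
  have "volterra \<alpha> (\<lambda>_. 1) (\<lambda>z. q z * f z) holomorphic_on \<Omega>"
  proof (rule volterra_holomorphic[OF _ _ _ _ \<sigma>])
    show "(\<lambda>z. q z * f z) holomorphic_on \<Omega>" by (intro holomorphic_intros on f)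
    show "0 \<le> (cmod (q \<alpha>) + C) * M" using constants M by simp
    fix z assume z: "z \<in> \<Omega>"
    let ?r = "cmod (z - \<alpha>)"
    have "cmod (q z * f z) \<le> ((cmod (q \<alpha>) + C) * exp (real (n + 1) * ?r)) * (M * (?r powr \<sigma> * exp (\<Lambda> * ?r)))"
      unfolding norm_mult using q_growth[OF z] M(2)[OF z] constants M(1) by (intro mult_mono) auto
    also have "\<dots> = (cmod (q \<alpha>) + C) * M * ?r powr \<sigma> * (exp (real (n + 1) * ?r) * exp (\<Lambda> * ?r))"
      by simp
    also have "exp (real (n + 1) * ?r) * exp (\<Lambda> * ?r) = exp ((real (n + 1) + \<Lambda>) * ?r)"
      by (simp add: exp_add[symmetric] algebra_simps)
    finally show "cmod (q z * f z) \<le> (cmod (q \<alpha>) + C) * M * ?r powr \<sigma> * exp ((real (n + 1) + \<Lambda>) * ?r)" .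
  qed simp
  moreover have "volterra \<alpha> K f holomorphic_on \<Omega>"
    using M by (intro volterra_holomorphic[OF hol(3) f M(1) _ \<sigma>]) (simp add: mult.assoc)
  ultimately show ?thesis
    unfolding T_def using p1_nz center
    by (intro holomorphic_intros on) auto
qed

text \<open>The exponents of the summands may differ because the lemma is applied to the power, of
  order \<open>\<tau> - 1\<close>, plus a correction of order \<tau>.\<close>

lemma T_add:
  assumes f: "f holomorphic_on \<Omega>" "M \<ge> 0"
      "\<And>z. z \<in> \<Omega> \<Longrightarrow> cmod (f z) \<le> M * (cmod (z - \<alpha>) powr \<sigma> * exp (\<Lambda> * cmod (z - \<alpha>)))"
    and g: "g holomorphic_on \<Omega>" "M' \<ge> 0"
      "\<And>z. z \<in> \<Omega> \<Longrightarrow> cmod (g z) \<le> M' * (cmod (z - \<alpha>) powr \<sigma>' * exp (\<Lambda> * cmod (z - \<alpha>)))"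
    and "\<sigma> > - 1" "\<sigma>' > - 1" "\<Lambda> > B" "a \<in> \<Omega>"
  shows "T (\<lambda>z. f z + g z) a = T f a + T g a"
proof -
  have split: "(\<lambda>z. q z * (f z + g z)) = (\<lambda>z. q z * f z + q z * g z)"
    by (simp add: algebra_simps)
  note F = estimates[OF f \<open>\<sigma> > - 1\<close> \<open>\<Lambda> > B\<close> \<open>a \<in> \<Omega>\<close>]
  note G = estimates[OF g \<open>\<sigma>' > - 1\<close> \<open>\<Lambda> > B\<close> \<open>a \<in> \<Omega>\<close>]
  have "volterra \<alpha> (\<lambda>_. 1) (\<lambda>z. q z * f z + q z * g z) a =
      volterra \<alpha> (\<lambda>_. 1) (\<lambda>z. q z * f z) a + volterra \<alpha> (\<lambda>_. 1) (\<lambda>z. q z * g z) a"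
    by (rule volterra_add[OF F(1) G(1)])
  moreover have "volterra \<alpha> K (\<lambda>z. f z + g z) a = volterra \<alpha> K f a + volterra \<alpha> K g a"
    by (rule volterra_add[OF F(2) G(2)])
  ultimately show ?thesis
    unfolding T_def split by (simp add: add_divide_distrib diff_divide_distrib)
qed

lemma T_cmult: "T (\<lambda>z. k * f z) a = k * T f a"
  using volterra_cmult[of \<alpha> "\<lambda>_. 1" k "\<lambda>z. q z * f z" a] volterra_cmult[of \<alpha> K k f a]
  by (simp add: T_def algebra_simps add_divide_distrib)

lemma T_diff:
  assumes f: "f holomorphic_on \<Omega>" "M \<ge> 0"
      "\<And>z. z \<in> \<Omega> \<Longrightarrow> cmod (f z) \<le> M * (cmod (z - \<alpha>) powr \<sigma> * exp (\<Lambda> * cmod (z - \<alpha>)))"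
    and g: "g holomorphic_on \<Omega>" "M' \<ge> 0"
      "\<And>z. z \<in> \<Omega> \<Longrightarrow> cmod (g z) \<le> M' * (cmod (z - \<alpha>) powr \<sigma> * exp (\<Lambda> * cmod (z - \<alpha>)))"
    and "\<sigma> > - 1" "\<Lambda> > B" "a \<in> \<Omega>"
  shows "T (\<lambda>z. f z - g z) a = T f a - T g a"
proof -
  have "(\<lambda>z. - 1 * g z) holomorphic_on \<Omega>" using g(1) by (intro holomorphic_intros)
  then have "T (\<lambda>z. f z + (- 1) * g z) a = T f a + T (\<lambda>z. - 1 * g z) a"
    by (intro T_add[where g = "\<lambda>z. - 1 * g z" and M' = M' and \<sigma>' = \<sigma>, OF f]) (use assms in auto)
  also have "T (\<lambda>z. - 1 * g z) a = - 1 * T g a" by (rule T_cmult)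
  finally show ?thesis by simp
qed

text \<open>The first term comes from the model operator. In the second, the share \<tau> is the
  error of replacing \<open>p1 \<alpha>\<close> by \<open>p1 a\<close>, and the share 1 is
  \<open>remainder\<close>. The third comes from \<open>K\<close>.\<close>

definition contraction_const :: "real \<Rightarrow> real" where
  "contraction_const \<Lambda> = \<tau> / (\<tau> + 1) + (\<tau> + 1) * (C / c) / \<Lambda> + N / c / (\<Lambda> - B)"

text \<open>The lower bound \<open>\<Lambda>0\<close> is free so that uniqueness can choose a weight
  above those of both given solutions.\<close>

lemma contracting_weight:
  obtains \<Lambda> where "\<Lambda> > \<Lambda>0" "\<Lambda> > B" "0 \<le> contraction_const \<Lambda>" "contraction_const \<Lambda> < 1"
proof -
  have 1: "((\<lambda>x. k / (x - B')) \<longlongrightarrow> 0) at_top" for k B' :: real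
    by (intro tendsto_divide_0[OF tendsto_const] filterlim_at_top_imp_at_infinity
        filterlim_tendsto_add_at_top[OF tendsto_const filterlim_ident, of "- B'", simplified])
  have "((\<lambda>\<Lambda>. \<tau> / (\<tau> + 1) + (\<tau> + 1) * (C / c) / (\<Lambda> - 0) + N / c / (\<Lambda> - B)) \<longlongrightarrow> \<tau> / (\<tau> + 1) + 0 + 0) at_top"
    by (intro tendsto_intros 1)
  then have "(contraction_const \<longlongrightarrow> \<tau> / (\<tau> + 1)) at_top"
    by (simp add: contraction_const_def[abs_def])
  moreover have "\<tau> / (\<tau> + 1) < 1" using constants by simp
  ultimately have "\<forall>\<^sub>F \<Lambda> in at_top. contraction_const \<Lambda> < 1"
    using order_tendstoD(2) by blast
  then have "\<forall>\<^sub>F \<Lambda> in at_top. contraction_const \<Lambda> < 1 \<and> \<Lambda> > \<Lambda>0 \<and> \<Lambda> > B"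
    by (intro eventually_conj eventually_gt_at_top)
  then obtain \<Lambda> where \<Lambda>: "contraction_const \<Lambda> < 1" "\<Lambda> > \<Lambda>0" "\<Lambda> > B"
    using eventually_happens' trivial_limit_at_top_linorder by (metis (no_types, lifting))
  moreover have "contraction_const \<Lambda> \<ge> 0"
    unfolding contraction_const_def using constants \<Lambda>(3)
    by (intro add_nonneg_nonneg divide_nonneg_nonneg mult_nonneg_nonneg) auto
  ultimately show ?thesis using that by blast
qed

text \<open>Near \<open>\<alpha>\<close> the operator behaves like \<open>f \<mapsto> (\<tau> / (z - \<alpha>)) \<integral> f\<close>, whose norm on functions of
  order \<open>\<tau>\<close> is \<open>\<tau> / (\<tau> + 1) < 1\<close>; every other contribution carries a factor \<open>1 / \<Lambda>\<close>.\<close>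

lemma T_contraction:
  assumes f: "f holomorphic_on \<Omega>" and M: "M \<ge> 0"
      "\<And>z. z \<in> \<Omega> \<Longrightarrow> cmod (f z) \<le> M * (cmod (z - \<alpha>) powr \<tau> * exp (\<Lambda> * cmod (z - \<alpha>)))"
    and \<Lambda>: "\<Lambda> > B" and a: "a \<in> \<Omega>"
  shows "cmod (T f a) \<le> contraction_const \<Lambda> * M * (cmod (a - \<alpha>) powr \<tau> * exp (\<Lambda> * cmod (a - \<alpha>)))"
proof -
  define r where "r = cmod (a - \<alpha>)"
  define G where "G = (1 + r) ^ n"
  define W where "W = M * (r powr \<tau> * exp (\<Lambda> * r))"
  define p where "p = cmod (p1 a)"
  have r: "r > 0" using norm_pos[OF a] by (simp add: r_def)
  have G: "G \<ge> 1" using r by (simp add: G_def)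
  have \<Lambda>0: "\<Lambda> > 0" using \<Lambda> constants by simp
  have \<tau>: "\<tau> > - 1" "\<tau> \<ge> 0" using constants by auto
  have W: "W \<ge> 0" using M by (simp add: W_def)
  have p: "p > 0" using p1_nz[OF a] by (simp add: p_def)
  have lower: "c * G \<le> p" using p1_lower[OF a] by (simp add: G_def r_def p_def)
  have Gp: "G / p \<le> 1 / c" using lower p constants by (simp add: field_simps)
  have onep: "1 / p \<le> 1 / c"
    using Gp G p by (smt (verit) divide_right_mono)
  note E = estimates[OF f M \<tau>(1) \<Lambda> a, folded r_def]
  \<comment> \<open>\<open>q \<alpha>\<close> is \<tau> times \<open>p1 \<alpha>\<close> up to sign,
    and \<open>p1 \<alpha> / p1 a\<close> is 1 up to a relative error of order \<open>r\<close>,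
    uniformly on the domain.\<close>
  have qa: "cmod (q \<alpha>) / p \<le> \<tau> * (1 + C / c * r)"
  proof -
    have "cmod (p1 \<alpha>) \<le> p + cmod (p1 a - p1 \<alpha>)"
      using norm_triangle_ineq4[of "p1 a" "p1 a - p1 \<alpha>"] by (simp add: p_def)
    also have "\<dots> \<le> p + C * r * G"
      using p1_incr[of a] by (simp add: r_def G_def)
    finally have "cmod (p1 \<alpha>) / p \<le> (p + C * r * G) / p"
      using p by (simp add: divide_right_mono)
    also have "\<dots> = 1 + C * r * (G / p)" using p by (simp add: field_simps)
    also have "\<dots> \<le> 1 + C * r * (1 / c)"
      using Gp constants r by (intro add_left_mono mult_left_mono) auto
    finally have "\<tau> * (cmod (p1 \<alpha>) / p) \<le> \<tau> * (1 + C * r * (1 / c))"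
      using constants by (intro mult_left_mono) auto
    then show ?thesis using constants by (simp add: q_center norm_mult)
  qed
  have V1: "cmod (volterra \<alpha> (\<lambda>_. 1) f a) / r \<le> W / (\<tau> + 1)"
    using E(4) r by (simp add: W_def powr_add field_simps)
  have V2: "cmod (volterra \<alpha> (\<lambda>_. 1) f a) \<le> W / \<Lambda>"
    using E(5)[OF _ \<tau>(2)] by (simp add: W_def mult.assoc)
  have "cmod (q \<alpha>) / p * (cmod (volterra \<alpha> (\<lambda>_. 1) f a) / r) \<le>
      \<tau> * (1 + C / c * r) * (cmod (volterra \<alpha> (\<lambda>_. 1) f a) / r)"
    using qa r by (intro mult_right_mono) auto
  \<comment> \<open>The term without \<open>r\<close> needs the sharp bound \<open>V1\<close>; in
    the error term the factor \<open>r\<close> cancels the division by \<open>r\<close>, so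
    \<open>V2\<close> applies and brings \<open>1 / \<Lambda>\<close>.\<close>
  also have "\<dots> = \<tau> * (cmod (volterra \<alpha> (\<lambda>_. 1) f a) / r) + \<tau> * (C / c) * cmod (volterra \<alpha> (\<lambda>_. 1) f a)"
    using r by (simp add: field_simps)
  also have "\<dots> \<le> \<tau> * (W / (\<tau> + 1)) + \<tau> * (C / c) * (W / \<Lambda>)"
    using V1 V2 constants by (intro add_mono mult_left_mono) auto
  finally have t1: "cmod (q \<alpha> * volterra \<alpha> (\<lambda>_. 1) f a) / (r * p) \<le>
      \<tau> * (W / (\<tau> + 1)) + \<tau> * (C / c) * (W / \<Lambda>)"
    by (simp add: norm_mult mult.commute)
  have "cmod (remainder f a) / (r * p) \<le> (C * G * M * r powr (\<tau> + 1) * exp (\<Lambda> * r) / \<Lambda>) / (r * p)"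
    using E(7) r p by (intro divide_right_mono) (auto simp: G_def)
  also have "\<dots> = C * (W / \<Lambda>) * (G / p)"
    using r by (simp add: W_def powr_add field_simps)
  also have "\<dots> \<le> C * (W / \<Lambda>) * (1 / c)"
    using Gp constants W \<Lambda>0 by (intro mult_left_mono) auto
  finally have t2: "cmod (remainder f a) / (r * p) \<le> (C / c) * (W / \<Lambda>)" by (simp add: mult.commute)
  have "cmod (volterra \<alpha> K f a) / (r * p) \<le> (N * r * M * r powr \<tau> * exp (\<Lambda> * r) / (\<Lambda> - B)) / (r * p)"
    using E(9)[OF _ \<tau>(2)] r p by (intro divide_right_mono) auto
  also have "\<dots> = N * (W / (\<Lambda> - B)) * (1 / p)"
    using r by (simp add: W_def)
  also have "\<dots> \<le> N * (W / (\<Lambda> - B)) * (1 / c)"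
    using onep constants W \<Lambda> by (intro mult_left_mono mult_nonneg_nonneg) auto
  finally have t3: "cmod (volterra \<alpha> K f a) / (r * p) \<le> (N / c) * (W / (\<Lambda> - B))"
    by (simp add: mult.commute)
  have Vq: "volterra \<alpha> (\<lambda>_. 1) (\<lambda>z. q z * f z) a = q \<alpha> * volterra \<alpha> (\<lambda>_. 1) f a + remainder f a"
    by (rule E(3))
  have "cmod (T f a) = cmod (q \<alpha> * volterra \<alpha> (\<lambda>_. 1) f a + remainder f a + volterra \<alpha> K f a) / (r * p)"
    unfolding T_def Vq by (simp add: norm_divide norm_mult r_def p_def norm_minus_cancel del: minus_add_distrib)
  also have "\<dots> \<le> (cmod (q \<alpha> * volterra \<alpha> (\<lambda>_. 1) f a) + cmod (remainder f a) + cmod (volterra \<alpha> K f a)) / (r * p)"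
    using r p by (intro divide_right_mono norm_triangle_mono norm_triangle_ineq) auto
  also have "\<dots> \<le> (\<tau> * (W / (\<tau> + 1)) + \<tau> * (C / c) * (W / \<Lambda>)) + (C / c) * (W / \<Lambda>) + (N / c) * (W / (\<Lambda> - B))"
    using t1 t2 t3 by (simp add: add_divide_distrib)
  also have "\<dots> = contraction_const \<Lambda> * W"
    by (simp add: contraction_const_def algebra_simps add_divide_distrib)
  finally show ?thesis by (simp add: W_def r_def mult.assoc)
qed

text \<open>The leading terms \<open>p1 \<alpha> * (a - \<alpha>) * b a\<close> and \<open>q \<alpha> * \<integral> b\<close> cancel because \<open>q \<alpha> = - \<tau> * p1 \<alpha>\<close>.\<close>

lemma T_power_defect:
  assumes b: "\<And>z. z \<in> \<Omega> \<Longrightarrow> (b has_field_derivative of_real (\<tau> - 1) / (z - \<alpha>) * b z) (at z)"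
    and nb: "\<And>z. z \<in> \<Omega> \<Longrightarrow> cmod (b z) = cmod (z - \<alpha>) powr (\<tau> - 1)"
    and \<Lambda>: "\<Lambda> > B" and a: "a \<in> \<Omega>"
  shows "cmod (T b a - b a) \<le> (C / c + C / c / (\<tau> + 1) + N / c / \<tau>) *
    (cmod (a - \<alpha>) powr \<tau> * exp (\<Lambda> * cmod (a - \<alpha>)))"
proof -
  define r where "r = cmod (a - \<alpha>)"
  define G where "G = (1 + r) ^ n"
  define W where "W = r powr \<tau> * exp (\<Lambda> * r)"
  define p where "p = cmod (p1 a)"
  have r: "r > 0" using norm_pos[OF a] by (simp add: r_def)
  have G: "G \<ge> 1" using r by (simp add: G_def)
  have \<Lambda>0: "\<Lambda> > 0" using \<Lambda> constants by simp
  have \<tau>: "\<tau> - 1 > - 1" using constants by auto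
  have W: "W \<ge> 0" by (simp add: W_def)
  have p: "p > 0" using p1_nz[OF a] by (simp add: p_def)
  have lower: "c * G \<le> p" using p1_lower[OF a] by (simp add: G_def r_def p_def)
  have Gp: "G / p \<le> 1 / c" using lower p constants by (simp add: field_simps)
  have onep: "1 / p \<le> 1 / c"
    using Gp G p by (smt (verit) divide_right_mono)
  have b_hol: "b holomorphic_on \<Omega>"
    using b open_dom holomorphic_on_open by blast
  have b_bd: "cmod (b z) \<le> 1 * (cmod (z - \<alpha>) powr (\<tau> - 1) * exp (\<Lambda> * cmod (z - \<alpha>)))" if "z \<in> \<Omega>" for z
    using nb[OF that] \<Lambda>0 by (simp add: mult_right_le_one_le mult_le_cancel_left1)
  \<comment> \<open>Here \<open>\<sigma> = \<tau> - 1\<close>, so the denominators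
    \<open>\<sigma> + 1\<close> and \<open>\<sigma> + 2\<close> become \<tau> and
    \<open>\<tau> + 1\<close>.\<close>
  note E = estimates[OF b_hol zero_le_one b_bd \<tau> \<Lambda> a, folded r_def]
  have Vq: "volterra \<alpha> (\<lambda>_. 1) (\<lambda>z. q z * b z) a = q \<alpha> * volterra \<alpha> (\<lambda>_. 1) b a + remainder b a"
    by (rule E(3))
  have Vb: "volterra \<alpha> (\<lambda>_. 1) b a = (a - \<alpha>) * b a / of_real \<tau>"
    by (rule volterra_power[OF constants(1) b nb a])
  have "a - \<alpha> \<noteq> 0" using r by (auto simp: r_def)
  then have "T b a - b a = - ((p1 a - p1 \<alpha>) * ((a - \<alpha>) * b a) + remainder b a + volterra \<alpha> K b a) / ((a - \<alpha>) * p1 a)"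
    unfolding T_def Vq Vb q_center
    using p1_nz[OF a] constants(1) by (simp add: field_simps)
  then have "cmod (T b a - b a) = cmod ((p1 a - p1 \<alpha>) * ((a - \<alpha>) * b a) + remainder b a + volterra \<alpha> K b a) / (r * p)"
    by (simp add: norm_divide norm_mult r_def p_def norm_minus_cancel del: minus_add_distrib)
  also have "\<dots> \<le> (cmod ((p1 a - p1 \<alpha>) * ((a - \<alpha>) * b a)) + cmod (remainder b a) + cmod (volterra \<alpha> K b a)) / (r * p)"
    using r p by (intro divide_right_mono norm_triangle_mono norm_triangle_ineq) auto
  finally have main: "cmod (T b a - b a) \<le> cmod ((p1 a - p1 \<alpha>) * ((a - \<alpha>) * b a)) / (r * p) +
      cmod (remainder b a) / (r * p) + cmod (volterra \<alpha> K b a) / (r * p)"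
    by (simp add: add_divide_distrib)
  have "cmod ((p1 a - p1 \<alpha>) * ((a - \<alpha>) * b a)) = cmod (p1 a - p1 \<alpha>) * r powr \<tau>"
    using r by (simp add: norm_mult nb[OF a] r_def powr_diff)
  also have "\<dots> \<le> (C * r * G) * W"
    using p1_incr[of a] r constants \<Lambda>0 by (intro mult_mono) (auto simp: r_def G_def W_def)
  finally have "cmod ((p1 a - p1 \<alpha>) * ((a - \<alpha>) * b a)) / (r * p) \<le> (C * r * G) * W / (r * p)"
    using r p by (intro divide_right_mono) auto
  also have "\<dots> = C * W * (G / p)" using r by simp
  also have "\<dots> \<le> C * W * (1 / c)" using Gp W constants by (intro mult_left_mono) auto
  finally have t1: "cmod ((p1 a - p1 \<alpha>) * ((a - \<alpha>) * b a)) / (r * p) \<le> C / c * W" by simp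
  have "cmod (remainder b a) / (r * p) \<le> (C * G * r powr (\<tau> + 1) * exp (\<Lambda> * r) / (\<tau> + 1)) / (r * p)"
    using E(6) r p by (intro divide_right_mono) (auto simp: G_def add.commute)
  also have "C * G * r powr (\<tau> + 1) * exp (\<Lambda> * r) / (\<tau> + 1) = C * (W / (\<tau> + 1)) * G * r"
    using r by (simp add: W_def powr_add)
  also have "C * (W / (\<tau> + 1)) * G * r / (r * p) = C * (W / (\<tau> + 1)) * (G / p)"
    using r by simp
  also have "\<dots> \<le> C * (W / (\<tau> + 1)) * (1 / c)"
    using Gp constants W by (intro mult_left_mono) auto
  finally have t2: "cmod (remainder b a) / (r * p) \<le> C / c / (\<tau> + 1) * W" by (simp add: mult_ac)
  have "cmod (volterra \<alpha> K b a) / (r * p) \<le> (N * r * r powr \<tau> * exp (\<Lambda> * r) / \<tau>) / (r * p)"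
    using E(8) r p by (intro divide_right_mono) auto
  also have "\<dots> = N * (W / \<tau>) * (1 / p)"
    using r by (simp add: W_def)
  also have "\<dots> \<le> N * (W / \<tau>) * (1 / c)"
    using onep constants W by (intro mult_left_mono mult_nonneg_nonneg) auto
  finally have t3: "cmod (volterra \<alpha> K b a) / (r * p) \<le> N / c / \<tau> * W" by (simp add: mult_ac)
  have "cmod (T b a - b a) \<le> (C / c + C / c / (\<tau> + 1) + N / c / \<tau>) * W"
    using main t1 t2 t3 by (simp add: distrib_right)
  then show ?thesis by (simp add: W_def r_def)
qed

section \<open>Existence and uniqueness for the fixed-point equation\<close>

lemma inhomogeneous_solution:
  assumes b: "\<And>z. z \<in> \<Omega> \<Longrightarrow> (b has_field_derivative of_real (\<tau> - 1) / (z - \<alpha>) * b z) (at z)"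
    and nb: "\<And>z. z \<in> \<Omega> \<Longrightarrow> cmod (b z) = cmod (z - \<alpha>) powr (\<tau> - 1)"
  obtains f where "f \<in> HL_inf_bullet \<tau> \<alpha> \<Omega>" "\<And>a. a \<in> \<Omega> \<Longrightarrow> b a + f a = T (\<lambda>z. b z + f z) a"
proof -
  obtain \<Lambda> where \<Lambda>: "\<Lambda> > B" "0 \<le> contraction_const \<Lambda>" "contraction_const \<Lambda> < 1"
    by (rule contracting_weight)
  define w where "w = (\<lambda>z. cmod (z - \<alpha>) powr \<tau> * exp (\<Lambda> * cmod (z - \<alpha>)))"
  have \<tau>: "\<tau> > - 1" "\<tau> - 1 > - 1" using constants by auto
  have \<Lambda>0: "\<Lambda> > 0" using \<Lambda>(1) constants by simp
  have b_hol: "b holomorphic_on \<Omega>"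
    using b open_dom holomorphic_on_open by blast
  have b_bd: "cmod (b z) \<le> 1 * (cmod (z - \<alpha>) powr (\<tau> - 1) * exp (\<Lambda> * cmod (z - \<alpha>)))" if "z \<in> \<Omega>" for z
    using nb[OF that] \<Lambda>0 by (simp add: mult_le_cancel_left1)
  define D where "D = C / c + C / c / (\<tau> + 1) + N / c / \<tau>"
  have D: "D \<ge> 0" unfolding D_def using constants by (intro add_nonneg_nonneg divide_nonneg_nonneg) auto
  have w_cont: "continuous_on \<Omega> w"
    unfolding w_def using center by (intro continuous_intros) auto
  have w_nonneg: "w z \<ge> 0" for z by (simp add: w_def)
  have g_hol: "(\<lambda>a. T b a - b a) holomorphic_on \<Omega>"
    by (intro holomorphic_intros b_hol T_holomorphic[OF b_hol zero_le_one b_bd \<tau>(2)])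
  have g_bd: "cmod (T b a - b a) \<le> D * w a" if "a \<in> \<Omega>" for a
    unfolding D_def w_def by (rule T_power_defect[OF b nb \<Lambda>(1) that])
  obtain f M where f: "f holomorphic_on \<Omega>" "\<And>z. z \<in> \<Omega> \<Longrightarrow> cmod (f z) \<le> M * w z" "M \<ge> 0"
    "\<And>z. z \<in> \<Omega> \<Longrightarrow> f z = T f z + (T b z - b z)"
  proof (rule neumann_series[OF open_dom w_cont w_nonneg \<Lambda>(2,3) _ _ _ g_hol g_bd D that])
    show "T f holomorphic_on \<Omega>"
      if "f holomorphic_on \<Omega>" "\<And>z. z \<in> \<Omega> \<Longrightarrow> cmod (f z) \<le> M * w z" "M \<ge> 0" for f M
      by (rule T_holomorphic[OF that(1,3) that(2)[unfolded w_def] \<tau>(1)])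
    show "cmod (T f z) \<le> contraction_const \<Lambda> * M * w z"
      if "f holomorphic_on \<Omega>" "\<And>z. z \<in> \<Omega> \<Longrightarrow> cmod (f z) \<le> M * w z" "M \<ge> 0" "z \<in> \<Omega>" for f M z
      using T_contraction[OF that(1,3) _ \<Lambda>(1) that(4)] that(2) by (simp add: w_def)
    show "T (\<lambda>z. f z - g z) z = T f z - T g z"
      if "f holomorphic_on \<Omega>" "\<And>z. z \<in> \<Omega> \<Longrightarrow> cmod (f z) \<le> M * w z"
        "g holomorphic_on \<Omega>" "\<And>z. z \<in> \<Omega> \<Longrightarrow> cmod (g z) \<le> M' * w z" "M \<ge> 0" "M' \<ge> 0" "z \<in> \<Omega>"
      for f g M M' z
      by (rule T_diff[OF that(1,5) _ that(3,6) _ \<tau>(1) \<Lambda>(1) that(7)])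
        (use that(2,4) in \<open>auto simp: w_def\<close>)
  qed
  have "f \<in> HL_inf \<tau> \<Lambda> \<alpha> \<Omega>"
    unfolding mem_HL_inf_iff using f(1,2,3) by (auto simp: w_def)
  moreover have "b a + f a = T (\<lambda>z. b z + f z) a" if "a \<in> \<Omega>" for a
  proof -
    have "T (\<lambda>z. b z + f z) a = T b a + T f a"
      by (rule T_add[OF b_hol zero_le_one b_bd f(1,3) _ \<tau>(2,1) \<Lambda>(1) that])
        (use f(2) in \<open>auto simp: w_def\<close>)
    then show ?thesis using f(4)[OF that] by simp
  qed
  ultimately show ?thesis using that unfolding HL_inf_bullet_def by blast
qed

text \<open>The two corrections may come with different exponential types. Both lie in the space of
  any larger type, where \<open>T\<close> can be made a contraction that fixes their
  difference.\<close>

lemma inhomogeneous_solution_unique: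
  assumes b: "\<And>z. z \<in> \<Omega> \<Longrightarrow> (b has_field_derivative of_real (\<tau> - 1) / (z - \<alpha>) * b z) (at z)"
    and nb: "\<And>z. z \<in> \<Omega> \<Longrightarrow> cmod (b z) = cmod (z - \<alpha>) powr (\<tau> - 1)"
    and f: "f \<in> HL_inf_bullet \<tau> \<alpha> \<Omega>" "\<And>a. a \<in> \<Omega> \<Longrightarrow> b a + f a = T (\<lambda>z. b z + f z) a"
    and g: "g \<in> HL_inf_bullet \<tau> \<alpha> \<Omega>" "\<And>a. a \<in> \<Omega> \<Longrightarrow> b a + g a = T (\<lambda>z. b z + g z) a"
    and a: "a \<in> \<Omega>"
  shows "f a = g a"
proof -
  obtain \<Lambda>1 \<Lambda>2 where "f \<in> HL_inf \<tau> \<Lambda>1 \<alpha> \<Omega>" "g \<in> HL_inf \<tau> \<Lambda>2 \<alpha> \<Omega>"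
    using f(1) g(1) unfolding HL_inf_bullet_def by blast
  moreover obtain \<Lambda> where \<Lambda>: "\<Lambda> > max \<Lambda>1 \<Lambda>2" "\<Lambda> > B" "0 \<le> contraction_const \<Lambda>" "contraction_const \<Lambda> < 1"
    by (rule contracting_weight)
  ultimately have fg: "f \<in> HL_inf \<tau> \<Lambda> \<alpha> \<Omega>" "g \<in> HL_inf \<tau> \<Lambda> \<alpha> \<Omega>"
    by (auto intro: HL_inf_mono)
  define w where "w = (\<lambda>z. cmod (z - \<alpha>) powr \<tau> * exp (\<Lambda> * cmod (z - \<alpha>)))"
  have \<tau>: "\<tau> > - 1" "\<tau> - 1 > - 1" using constants by auto
  have \<Lambda>0: "\<Lambda> > 0" using \<Lambda>(2) constants by simp
  have b_hol: "b holomorphic_on \<Omega>"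
    using b open_dom holomorphic_on_open by blast
  have b_bd: "cmod (b z) \<le> 1 * (cmod (z - \<alpha>) powr (\<tau> - 1) * exp (\<Lambda> * cmod (z - \<alpha>)))" if "z \<in> \<Omega>" for z
    using nb[OF that] \<Lambda>0 by (simp add: mult_le_cancel_left1)
  have T_split: "f z = T f z + (T b z - b z)"
    if "f \<in> HL_inf \<tau> \<Lambda> \<alpha> \<Omega>" "b z + f z = T (\<lambda>z. b z + f z) z" "z \<in> \<Omega>" for f z
  proof -
    obtain M where M: "M \<ge> 0" "f holomorphic_on \<Omega>"
      "\<And>z. z \<in> \<Omega> \<Longrightarrow> cmod (f z) \<le> M * (cmod (z - \<alpha>) powr \<tau> * exp (\<Lambda> * cmod (z - \<alpha>)))"
      using \<open>f \<in> HL_inf \<tau> \<Lambda> \<alpha> \<Omega>\<close> unfolding mem_HL_inf_iff by blast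
    have "T (\<lambda>z. b z + f z) z = T b z + T f z"
      by (rule T_add[OF b_hol zero_le_one b_bd M(2,1) _ \<tau>(2,1) \<Lambda>(2) that(3)])
        (use M(3) in auto)
    then show ?thesis using that(2) by (simp add: algebra_simps)
  qed
  obtain M1 where M1: "M1 \<ge> 0" "f holomorphic_on \<Omega>"
      "\<And>z. z \<in> \<Omega> \<Longrightarrow> cmod (f z) \<le> M1 * (cmod (z - \<alpha>) powr \<tau> * exp (\<Lambda> * cmod (z - \<alpha>)))"
    using fg(1) unfolding mem_HL_inf_iff by blast
  obtain M2 where M2: "M2 \<ge> 0" "g holomorphic_on \<Omega>"
      "\<And>z. z \<in> \<Omega> \<Longrightarrow> cmod (g z) \<le> M2 * (cmod (z - \<alpha>) powr \<tau> * exp (\<Lambda> * cmod (z - \<alpha>)))"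
    using fg(2) unfolding mem_HL_inf_iff by blast
  have fixed: "f z - g z = T (\<lambda>z. f z - g z) z" if "z \<in> \<Omega>" for z
  proof -
    have "T (\<lambda>z. f z - g z) z = T f z - T g z"
      by (rule T_diff[OF M1(2,1) _ M2(2,1) _ \<tau>(1) \<Lambda>(2) that]) (use M1(3) M2(3) in auto)
    then show ?thesis
      using T_split[OF fg(1) f(2)[OF that] that] T_split[OF fg(2) g(2)[OF that] that]
      by (metis add_diff_cancel_right)
  qed
  obtain M where M: "M \<ge> 0" "(\<lambda>z. f z - g z) holomorphic_on \<Omega>"
      "\<And>z. z \<in> \<Omega> \<Longrightarrow> cmod (f z - g z) \<le> M * w z"
    using HL_inf_diff[OF fg] unfolding mem_HL_inf_iff w_def by blast
  have "f a - g a = 0"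
  proof (rule contraction_fixed_zero[where T = T and f = "\<lambda>z. f z - g z",
        OF \<Lambda>(3,4) _ M(2,3,1) fixed a])
    show "cmod (T f z) \<le> contraction_const \<Lambda> * M * w z"
      if "f holomorphic_on \<Omega>" "\<And>z. z \<in> \<Omega> \<Longrightarrow> cmod (f z) \<le> M * w z" "M \<ge> 0" "z \<in> \<Omega>" for f M z
      using T_contraction[OF that(1,3) _ \<Lambda>(2) that(4)] that(2) by (simp add: w_def)
  qed
  then show ?thesis by simp
qed

end

section \<open>The regular singular solution\<close>

theorem theorem4p5:
  fixes P Q :: "complex poly" and R :: "nat \<Rightarrow> complex" and d :: nat
    and A \<tau> :: real and \<alpha> :: complex and \<Omega> :: "complex set"
    and branch :: "complex \<Rightarrow> complex"
  defines "affine_space \<equiv> {(\<lambda>\<zeta>. branch \<zeta> + f \<zeta>) | f. f \<in> HL_inf_bullet \<tau> \<alpha> \<Omega>}"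
  assumes P_monic: "lead_coeff P = 1" and P_degree: "degree P = d"
    and P_simple: "\<And>z. poly P z = 0 \<Longrightarrow> order z P = 1"
    and Q_degree: "degree Q = d - 1"
    and Q_nonzero: "\<And>z. poly P z = 0 \<Longrightarrow> poly Q z \<noteq> 0"
    and A_nonneg: "A \<ge> 0"
    and R_converges: "\<And>z. cmod z > A \<Longrightarrow> summable (\<lambda>j. R j * inverse z ^ j)"
    and root: "poly P (- \<alpha>) = 0"
    and tau: "complex_of_real \<tau> = poly Q (- \<alpha>) / poly (pderiv P) (- \<alpha>)" and tau_pos: "\<tau> > 0"
    and Omega_open: "open \<Omega>" and Omega_sc: "simply_connected \<Omega>"
    and Omega_star: "star_shaped_around \<alpha> \<Omega>"
    and alpha_notin: "\<alpha> \<notin> \<Omega>" and alpha_closure: "\<alpha> \<in> closure \<Omega>"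
    and no_other_roots: "\<And>\<zeta>. \<zeta> \<in> closure \<Omega> \<Longrightarrow> poly P (- \<zeta>) = 0 \<Longrightarrow> \<zeta> = \<alpha>"
    and branch: "power_branch (complex_of_real (\<tau> - 1)) \<alpha> \<Omega> branch"
  shows "affine_space \<subseteq> HL_inf_bullet (\<tau> - 1) \<alpha> \<Omega> \<and>
    (\<exists>\<psi>\<in>affine_space. (\<forall>a\<in>\<Omega>. P_hat P Q R \<alpha> \<psi> a = 0) \<and>
       (\<forall>\<phi>\<in>affine_space. (\<forall>a\<in>\<Omega>. P_hat P Q R \<alpha> \<phi> a = 0) \<longrightarrow> (\<forall>a\<in>\<Omega>. \<phi> a = \<psi> a)))"
proof -
  interpret punctured_star \<alpha> \<Omega>
    using Omega_open Omega_star alpha_notin by unfold_locales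
  note b = power_branch_properties[OF branch]
  have b_hol: "branch holomorphic_on \<Omega>"
    using b(1) Omega_open holomorphic_on_open by blast
  have b_HL: "branch \<in> HL_inf (\<tau> - 1) 0 \<alpha> \<Omega>"
    unfolding mem_HL_inf_iff using b_hol b(2) by (auto intro!: exI[of _ 1])
  have sub: "affine_space \<subseteq> HL_inf_bullet (\<tau> - 1) \<alpha> \<Omega>"
  proof
    fix \<phi> assume "\<phi> \<in> affine_space"
    then obtain f \<Lambda> where \<phi>: "\<phi> = (\<lambda>\<zeta>. branch \<zeta> + f \<zeta>)" "f \<in> HL_inf \<tau> \<Lambda> \<alpha> \<Omega>"
      unfolding affine_space_def HL_inf_bullet_def by blast
    then have "f \<in> HL_inf (\<tau> - 1) (\<Lambda> + 1) \<alpha> \<Omega>"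
      using HL_inf_shift_exponent[of f "\<tau> - 1" \<Lambda>] by simp
    \<comment> \<open>The branch has type 0 and the correction type \<open>\<Lambda> + 1\<close>;
      the maximum serves both.\<close>
    then have "f \<in> HL_inf (\<tau> - 1) (max 0 (\<Lambda> + 1)) \<alpha> \<Omega>" "branch \<in> HL_inf (\<tau> - 1) (max 0 (\<Lambda> + 1)) \<alpha> \<Omega>"
      using b_HL by (auto intro: HL_inf_mono)
    then have "\<phi> \<in> HL_inf (\<tau> - 1) (max 0 (\<Lambda> + 1)) \<alpha> \<Omega>"
      unfolding \<phi>(1) by (rule HL_inf_add[rotated])
    then show "\<phi> \<in> HL_inf_bullet (\<tau> - 1) \<alpha> \<Omega>"
      unfolding HL_inf_bullet_def by blast
  qed

  define p where "p = pcompose P [:0, - 1:]"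
  define q where "q = pcompose Q [:0, - 1:]"
  have poly_p: "poly p z = poly P (- z)" and poly_q: "poly q z = poly Q (- z)" for z
    by (simp_all add: p_def q_def poly_pcompose)
  have "poly p \<alpha> = 0" using root by (simp add: poly_p)
  then obtain p1 where p1: "p = [:- \<alpha>, 1:] * p1"
    using poly_eq_0_iff_dvd by (metis dvdE)
  have p1_eval: "poly P (- z) = (z - \<alpha>) * poly p1 z" for z
    unfolding poly_p[symmetric] p1 by (simp add: algebra_simps)
  have "P \<noteq> 0" using P_monic by auto
  \<comment> \<open>The reflection \<open>z \<mapsto> - z\<close> contributes the sign that turns
    the definition of \<tau> into \<open>q \<alpha> = - \<tau> * p1 \<alpha>\<close>.\<close>
  have "poly p1 \<alpha> = poly (pderiv p) \<alpha>"
    unfolding p1 by (simp add: pderiv_mult pderiv_pCons del: mult_pCons_left)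
  also have "\<dots> = - poly (pderiv P) (- \<alpha>)"
    by (simp add: p_def pderiv_pcompose pderiv_pCons poly_pcompose)
  finally have p1_center: "poly p1 \<alpha> = - poly (pderiv P) (- \<alpha>)" .
  \<comment> \<open>Division by zero yields 0, so a vanishing derivative would force
    \<open>\<tau> = 0\<close>.\<close>
  have nz: "poly (pderiv P) (- \<alpha>) \<noteq> 0"
    using tau tau_pos by auto
  then have q_center: "poly q \<alpha> = - of_real \<tau> * poly p1 \<alpha>"
    unfolding tau poly_q p1_center by simp
  have "p1 \<noteq> 0" using nz p1_center by auto
  have "degree p = d" using P_degree by (simp add: p_def degree_pcompose)
  then have deg_p1: "degree p1 = d - 1"
    using \<open>p1 \<noteq> 0\<close> unfolding p1 by (simp add: degree_mult_eq del: mult_pCons_left)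
  have deg_q: "degree q = d - 1" using Q_degree by (simp add: q_def degree_pcompose)
  \<comment> \<open>At \<alpha> this is \<open>nz\<close>, elsewhere the absence of other roots. The
    closure is needed because the lower bound rests on a positive distance to each root.\<close>
  have p1_nz: "poly p1 z \<noteq> 0" if "z \<in> closure \<Omega>" for z
    using no_other_roots[OF that] p1_eval[of z] nz p1_center by auto
  obtain c where c: "c > 0"
    "\<And>z. z \<in> closure \<Omega> \<Longrightarrow> c * (1 + cmod (z - \<alpha>)) ^ (d - 1) \<le> cmod (poly p1 z)"
    using poly_lower_bound[OF closed_closure p1_nz \<open>p1 \<noteq> 0\<close>, where \<alpha> = \<alpha>] unfolding deg_p1 by blast
  obtain C1 where C1: "C1 \<ge> 0"
    "\<And>z. cmod (poly p1 z - poly p1 \<alpha>) \<le> C1 * cmod (z - \<alpha>) * (1 + cmod (z - \<alpha>)) ^ (d - 1)"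
    using poly_increment_bound[of p1 "d - 1" \<alpha>] deg_p1 by auto
  obtain C2 where C2: "C2 \<ge> 0"
    "\<And>z. cmod (poly q z - poly q \<alpha>) \<le> C2 * cmod (z - \<alpha>) * (1 + cmod (z - \<alpha>)) ^ (d - 1)"
    using poly_increment_bound[of q "d - 1" \<alpha>] deg_q by auto
  obtain K N B where K: "K holomorphic_on UNIV" "N \<ge> 0" "B > 0"
    "\<And>a a'. kernel_R R a a' = K (a - a')" "\<And>u. cmod (K u) \<le> N * cmod u * exp (B * cmod u)"
    using kernel_R_entire[OF A_nonneg R_converges] by blast
  interpret E: regular_volterra_equation \<alpha> \<Omega> "poly p1" "poly q" K \<tau> c "max C1 C2" N B "d - 1"
  proof unfold_locales
    show "c * (1 + cmod (z - \<alpha>)) ^ (d - 1) \<le> cmod (poly p1 z)" if "z \<in> \<Omega>" for z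
      using c(2) that closure_subset by blast
    show "cmod (poly p1 z - poly p1 \<alpha>) \<le> max C1 C2 * cmod (z - \<alpha>) * (1 + cmod (z - \<alpha>)) ^ (d - 1)" for z
      by (rule order_trans[OF C1(2)]) (intro mult_right_mono, auto)
    show "cmod (poly q z - poly q \<alpha>) \<le> max C1 C2 * cmod (z - \<alpha>) * (1 + cmod (z - \<alpha>)) ^ (d - 1)" for z
      by (rule order_trans[OF C2(2)]) (intro mult_right_mono, auto)
  qed (use tau_pos c(1) C1(1) K q_center in \<open>auto intro!: holomorphic_intros\<close>)

  \<comment> \<open>The equivalence is pointwise and holds for arbitrary \<open>\<phi>\<close>: the
    same integrals stand on both sides, and \<open>(a - \<alpha>) * p1 a\<close> is nonzero on the
    domain.\<close>
  have P_hat_eq: "P_hat P Q R \<alpha> \<phi> a = 0 \<longleftrightarrow> \<phi> a = E.T \<phi> a" if a: "a \<in> \<Omega>" for \<phi> a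
  proof -
    have "contour_integral (linepath \<alpha> a) (\<lambda>a'. poly Q (- a') * \<phi> a') =
        volterra \<alpha> (\<lambda>_. 1) (\<lambda>z. poly q z * \<phi> z) a"
      using contour_integral_linepath_eq_volterra[of \<alpha> a "\<lambda>_. 1" "\<lambda>z. poly q z * \<phi> z"] by (simp add: poly_q)
    then have "P_hat P Q R \<alpha> \<phi> a = (a - \<alpha>) * poly p1 a * \<phi> a +
        volterra \<alpha> (\<lambda>_. 1) (\<lambda>z. poly q z * \<phi> z) a + volterra \<alpha> K \<phi> a"
      by (simp add: P_hat_def p1_eval K(4) contour_integral_linepath_eq_volterra)
    moreover have "(a - \<alpha>) * poly p1 a \<noteq> 0"
      using a alpha_notin E.p1_nz by auto
    ultimately show ?thesis
      unfolding E.T_def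
      by (metis (no_types, lifting) add.assoc eq_neg_iff_add_eq_0 mult.commute nonzero_eq_divide_eq)
  qed

  obtain f where f: "f \<in> HL_inf_bullet \<tau> \<alpha> \<Omega>"
    "\<And>a. a \<in> \<Omega> \<Longrightarrow> branch a + f a = E.T (\<lambda>z. branch z + f z) a"
    using E.inhomogeneous_solution[OF b] by blast
  have "(\<lambda>z. branch z + f z) \<in> affine_space"
    unfolding affine_space_def using f(1) by blast
  moreover have "\<forall>a\<in>\<Omega>. P_hat P Q R \<alpha> (\<lambda>z. branch z + f z) a = 0"
    using P_hat_eq f(2) by simp
  moreover have "\<phi> a = branch a + f a"
    if \<phi>: "\<phi> \<in> affine_space" "\<forall>a\<in>\<Omega>. P_hat P Q R \<alpha> \<phi> a = 0" and a: "a \<in> \<Omega>" for \<phi> a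
  proof -
    obtain g where g: "g \<in> HL_inf_bullet \<tau> \<alpha> \<Omega>" "\<phi> = (\<lambda>z. branch z + g z)"
      using \<phi>(1) unfolding affine_space_def by blast
    have "branch a + g a = E.T (\<lambda>z. branch z + g z) a" if "a \<in> \<Omega>" for a
      using \<phi>(2) P_hat_eq[OF that, of \<phi>] that g(2) by simp
    then have "g a = f a"
      using E.inhomogeneous_solution_unique[OF b g(1) _ f a] by blast
    then show ?thesis by (simp add: g(2))
  qed
  ultimately show ?thesis using sub by blast
qed

end
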